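(* Suppose that $\mathcal{F}\subset 2^{[n]}$ is $u$-union. (i) If $u=2s$, then $\beta(\mathcal{F})\leq\sum_{0\leq j\leq s-1}\binom{n-2}{j}$. (ii) If $u=2s+1$ and $n\geq\max\{4(s+2)^2,\,36(s+7)\}$, then $\beta(\mathcal{F})\leq\sum_{0\leq j\leq s-1}\binom{n-2}{j}+\binom{n-4}{s-2}$.
   Context: $2^{[n]}$ is the power set of $[n]=\{1,\dots,n\}$. A family $\mathcal{F}$ is $u$-union if $|F\cup F'|\leq u$ for all $F,F'\in\mathcal{F}$. For distinct $i,j\in[n]$, let $b_{ij}(\mathcal{F})=|\{F\in\mathcal{F}\colon i\in F,\ j\notin F\}|$; the sturdiness is $\beta(\mathcal{F})=\min_{1\leq i\neq j\leq n} b_{ij}(\mathcal{F})$. Binomial coefficients with negative lower index are $0$.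
   Formalization: Part (i) is proved under the added condition n > u = 2s (and n ≥ 2); without it the claim fails, e.g. for s = 2, n = u = 4 and the full power set, where the sturdiness is 4 but the bound is 3; for n ≤ s+1 the bound is trivial. *)

theory Defs
  imports Main
begin

definition u_union :: "nat \<Rightarrow> nat set set \<Rightarrow> bool" where
  "u_union u \<F> \<longleftrightarrow> (\<forall>F\<in>\<F>. \<forall>F'\<in>\<F>. card (F \<union> F') \<le> u)"

definition sep_count :: "nat set set \<Rightarrow> nat \<Rightarrow> nat \<Rightarrow> nat" where
  "sep_count \<F> i j = card {F \<in> \<F>. i \<in> F \<and> j \<notin> F}"

(* The set of values is nonempty, so that the minimum is meaningful, exactly when n \<ge> 2. *)
definition sturdiness :: "nat \<Rightarrow> nat set set \<Rightarrow> nat" where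
  "sturdiness n \<F> = Min {sep_count \<F> i j | i j. i \<in> {1..n} \<and> j \<in> {1..n} \<and> i \<noteq> j}"

(* The lower index is an integer: with natural-number subtraction, s - 2 would be 0
   for s < 2 and the binomial coefficient would wrongly become 1 instead of 0. *)
definition binom :: "nat \<Rightarrow> int \<Rightarrow> nat" where
  "binom m k = (if k < 0 then 0 else m choose nat k)"

end

theory Submission
  imports Defs
begin

text \<open>
  Averaging \<open>b\<^sub>i\<^sub>j\<close> over all ordered pairs turns (i) into a bound on the sum of \<open>\<bar>F\<bar>(n - \<bar>F\<bar>)\<close>. Levels \<open>l\<close> and
  \<open>2s + 1 - l\<close> are paired: every \<open>l\<close>-set disjoint from a member of level \<open>2s + 1 - l\<close> is missing from
  the family, and Katona's intersecting shadow theorem, applied to complements, says that enough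
  \<open>l\<close>-sets are missing to pay for the larger members.

  In (ii) the level \<open>s + 1\<close> is an intersecting family of \<open>k\<close>-sets, \<open>k = s + 1\<close>. The key fact is that either
  some point is missed by few members or all members contain two of three fixed points.
  Otherwise Kruskal--Katona gives a dichotomy for every small set \<open>S\<close>: either \<open>S\<close> is nearly a cover,
  or few members contain \<open>S\<close>. Near covers with two points lead to the triangle; without near covers,
  branching over the points of a member not meeting \<open>S\<close> multiplies by \<open>k\<close> but gains a factor \<open>4k\<close>, so
  all degrees are too small. If all members have at most \<open>s + 1\<close> points, this settles (ii); a larger
  member destroys most of level \<open>s\<close>, and averaging over the pairs \<open>(i, x)\<close>, for a point \<open>x\<close> missed by few
  members of level \<open>s + 1\<close>, gives even the bound without the second binomial coefficient.
\<close>

section \<open>Shifting\<close>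

definition swp :: "'a \<Rightarrow> 'a \<Rightarrow> 'a set \<Rightarrow> 'a set" where
  "swp i j C = insert i (C - {j})"

definition shift :: "'a \<Rightarrow> 'a \<Rightarrow> 'a set set \<Rightarrow> 'a set set" where
  "shift i j \<C> = (\<lambda>C. if j \<in> C \<and> i \<notin> C \<and> swp i j C \<notin> \<C> then swp i j C else C) ` \<C>"

text \<open>Sets of any fixed size below a member, not only one size down. Without
  \<open>finite B\<close>, infinite subsets of an infinite member would count at level 0, the value
  of \<open>card\<close> for them.\<close>

definition shad :: "nat \<Rightarrow> 'a set set \<Rightarrow> 'a set set" where
  "shad l \<C> = {B. finite B \<and> card B = l \<and> (\<exists>C\<in>\<C>. B \<subseteq> C)}"

definition pairwise_meet :: "nat \<Rightarrow> 'a set set \<Rightarrow> bool" where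
  "pairwise_meet t \<C> \<longleftrightarrow> (\<forall>A\<in>\<C>. \<forall>B\<in>\<C>. t \<le> card (A \<inter> B))"

lemma swp_swp: "j \<in> C \<Longrightarrow> i \<notin> C \<Longrightarrow> swp j i (swp i j C) = C"
  by (auto simp: swp_def)

lemma card_swp: "finite C \<Longrightarrow> j \<in> C \<Longrightarrow> i \<notin> C \<Longrightarrow> card (swp i j C) = card C"
  by (simp add: swp_def) (metis card_Suc_Diff1 One_nat_def card_Diff_singleton)

text \<open>Turns the image into a test on a set and its swap, so that later arguments are case
  analyses on \<open>i \<in> D\<close> and \<open>j \<in> D\<close>.\<close>

lemma mem_shift:
  assumes "i \<noteq> j"
  shows "D \<in> shift i j \<C> \<longleftrightarrow>
    (if j \<in> D \<and> i \<notin> D then D \<in> \<C> \<and> swp i j D \<in> \<C>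
     else if i \<in> D \<and> j \<notin> D then D \<in> \<C> \<or> swp j i D \<in> \<C>
     else D \<in> \<C>)" (is "_ \<longleftrightarrow> ?R")
proof
  assume "D \<in> shift i j \<C>"
  then obtain C where C: "C \<in> \<C>"
    "D = (if j \<in> C \<and> i \<notin> C \<and> swp i j C \<notin> \<C> then swp i j C else C)"
    unfolding shift_def by blast
  show ?R
  proof (cases "j \<in> C \<and> i \<notin> C \<and> swp i j C \<notin> \<C>")
    case True
    then have "D = swp i j C" using C by simp
    moreover have "i \<in> swp i j C" "j \<notin> swp i j C" using assms by (auto simp: swp_def)
    ultimately show ?R using C True swp_swp by (metis)
  next
    case False
    then show ?R using C by auto
  qed
next
  assume R: ?R
  show "D \<in> shift i j \<C>"
  proof (cases "D \<in> \<C>")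
    case True
    then have "D = (if j \<in> D \<and> i \<notin> D \<and> swp i j D \<notin> \<C> then swp i j D else D)"
      using R by auto
    then show ?thesis unfolding shift_def using True by blast
  next
    case False
    then have D: "i \<in> D" "j \<notin> D" "swp j i D \<in> \<C>" using R by (auto split: if_splits)
    have "swp i j (swp j i D) = D" using D swp_swp by metis
    moreover have "j \<in> swp j i D" "i \<notin> swp j i D" using assms by (auto simp: swp_def)
    ultimately show ?thesis unfolding shift_def using D(3) False by (intro image_eqI[of _ _ "swp j i D"]) auto
  qed
qed

lemma card_shift: "card (shift i j \<C>) = card \<C>"
proof -
  have "inj_on (\<lambda>C. if j \<in> C \<and> i \<notin> C \<and> swp i j C \<notin> \<C> then swp i j C else C) \<C>"
    by (rule inj_onI) (metis swp_swp)
  then show ?thesis unfolding shift_def by (rule card_image)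
qed

lemma finite_shift: "finite \<C> \<Longrightarrow> finite (shift i j \<C>)"
  by (simp add: shift_def)

lemma shift_uniform:
  assumes "\<And>C. C \<in> \<C> \<Longrightarrow> finite C \<and> card C = a" "D \<in> shift i j \<C>"
  shows "finite D \<and> card D = a"
  using assms unfolding shift_def by (auto simp: card_swp) (auto simp: swp_def)

lemma shift_subset_Pow:
  assumes "\<C> \<subseteq> Pow X" "i \<in> X"
  shows "shift i j \<C> \<subseteq> Pow X"
  using assms unfolding shift_def by (auto simp: swp_def split: if_splits)

text \<open>If \<open>D\<close> is new or \<open>B\<close> has to be moved, the required set lies
  below a swapped version of \<open>D\<close>. As shifting preserves cardinality, shadows do not
  grow.\<close>

lemma shad_shift:
  assumes "i \<noteq> j"
  shows "shad l (shift i j \<C>) \<subseteq> shift i j (shad l \<C>)"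
proof
  fix B assume "B \<in> shad l (shift i j \<C>)"
  then obtain D where B: "finite B" "card B = l" and D: "D \<in> shift i j \<C>" and BD: "B \<subseteq> D"
    unfolding shad_def by blast
  have T: "X \<in> shad l \<C>" if "finite X" "card X = l" "Y \<in> \<C>" "X \<subseteq> Y" for X Y
    using that unfolding shad_def by blast
  consider (j) "j \<in> B" "i \<notin> B" | (i) "i \<in> B" "j \<notin> B" | (both) "i \<in> B" "j \<in> B" | (none) "i \<notin> B" "j \<notin> B"
    by blast
  then show "B \<in> shift i j (shad l \<C>)"
  proof cases
    case j
    have "card (swp i j B) = l" "finite (swp i j B)" using j B by (auto simp: card_swp) (auto simp: swp_def)
    moreover have "D \<in> \<C>" using D BD j by (auto simp: mem_shift[OF assms] split: if_splits)
    moreover have "\<exists>Y\<in>\<C>. swp i j B \<subseteq> Y"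
    proof (cases "i \<in> D")
      case True
      then show ?thesis using \<open>D \<in> \<C>\<close> BD by (auto simp: swp_def)
    next
      case False
      then have "swp i j D \<in> \<C>" using D BD j by (auto simp: mem_shift[OF assms])
      then show ?thesis using BD by (intro bexI[of _ "swp i j D"]) (auto simp: swp_def)
    qed
    ultimately show ?thesis using j B BD T by (auto simp: mem_shift[OF assms])
  next
    case i
    have c: "card (swp j i B) = l" "finite (swp j i B)" using i B by (auto simp: card_swp) (auto simp: swp_def)
    have "D \<in> \<C> \<or> (j \<notin> D \<and> swp j i D \<in> \<C>)" using D BD i by (auto simp: mem_shift[OF assms] split: if_splits)
    then have "B \<in> shad l \<C> \<or> swp j i B \<in> shad l \<C>"
    proof
      assume "j \<notin> D \<and> swp j i D \<in> \<C>"
      then show ?thesis using T[OF c(2,1), of "swp j i D"] BD by (auto simp: swp_def)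
    qed (use T B BD in blast)
    then show ?thesis using i by (auto simp: mem_shift[OF assms])
  next
    case both
    then have "i \<in> D" "j \<in> D" using BD by auto
    then have "D \<in> \<C>" using D by (simp add: mem_shift[OF assms])
    then have "B \<in> shad l \<C>" using T B BD by blast
    then show ?thesis using both by (auto simp: mem_shift[OF assms])
  next
    case none
    have "D \<in> \<C> \<or> swp j i D \<in> \<C>" using D by (auto simp: mem_shift[OF assms] split: if_splits)
    then have "B \<in> shad l \<C>"
    proof
      assume "swp j i D \<in> \<C>"
      then show ?thesis using T[OF B, of "swp j i D"] BD none by (auto simp: swp_def)
    qed (use T B BD in blast)
    then show ?thesis using none by (auto simp: mem_shift[OF assms])
  qed
qed

lemma finite_shad:
  assumes "finite \<C>" "\<And>C. C \<in> \<C> \<Longrightarrow> finite C"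
  shows "finite (shad l \<C>)"
proof (rule finite_subset)
  show "shad l \<C> \<subseteq> Pow (\<Union>\<C>)" unfolding shad_def by auto
qed (use assms in auto)

lemma card_shad_shift:
  assumes "i \<noteq> j" "finite \<C>" "\<And>C. C \<in> \<C> \<Longrightarrow> finite C"
  shows "card (shad l (shift i j \<C>)) \<le> card (shad l \<C>)"
  using card_mono[OF _ shad_shift[OF assms(1)]] finite_shift finite_shad[OF assms(2,3)] card_shift
  by metis

text \<open>Two old members cause no problem, so \<open>one\<close> takes a new \<open>A\<close>,
  which came from \<open>swp j i A\<close>. If \<open>B\<close> is new as well, undoing both swaps
  preserves the size of the intersection. If \<open>B\<close> is old and has \<open>j\<close>
  without \<open>i\<close>, it survived because \<open>swp i j B\<close> is a member too, and that
  set is compared with \<open>swp j i A\<close>; otherwise \<open>B\<close> itself serves.\<close>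

lemma pairwise_meet_shift:
  assumes ij: "i \<noteq> j" and fin: "\<And>C. C \<in> \<C> \<Longrightarrow> finite C" and t: "pairwise_meet t \<C>"
  shows "pairwise_meet t (shift i j \<C>)"
proof -
  have tm: "t \<le> card (A \<inter> B)" if "A \<in> \<C>" "B \<in> \<C>" for A B
    using t that unfolding pairwise_meet_def by blast
  have one: "t \<le> card (A \<inter> B)" if A: "A \<in> shift i j \<C>" "A \<notin> \<C>" and B: "B \<in> shift i j \<C>" for A B
  proof -
    have Ai: "i \<in> A" "j \<notin> A" and A': "swp j i A \<in> \<C>"
      using A by (auto simp: mem_shift[OF ij] split: if_splits)
    show ?thesis
    proof (cases "B \<in> \<C>")
      case False
      then have Bi: "i \<in> B" "j \<notin> B" and B': "swp j i B \<in> \<C>"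
        using B by (auto simp: mem_shift[OF ij] split: if_splits)
      have fA: "finite A" using fin[OF A'] by (simp add: swp_def)
      have "swp j i A \<inter> swp j i B = swp j i (A \<inter> B)" by (auto simp: swp_def)
      then have "card (swp j i A \<inter> swp j i B) = card (A \<inter> B)" 
        using Ai Bi fA by (simp add: card_swp)
      then show ?thesis using tm[OF A' B'] by simp
    next
      case True
      have fB: "finite B" using fin True by blast
      have "\<exists>C\<in>\<C>. card (swp j i A \<inter> C) \<le> card (A \<inter> B)"
      proof (cases "j \<in> B \<and> i \<notin> B")
        case T: True
        then have "swp i j B \<in> \<C>" using B by (auto simp: mem_shift[OF ij])
        moreover have "swp j i A \<inter> swp i j B \<subseteq> A \<inter> B" using Ai ij by (auto simp: swp_def)
        ultimately show ?thesis using fB by (meson card_mono finite_Int)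
      next
        case F: False
        show ?thesis
        proof (cases "j \<in> B")
          case True
          then have "swp j i A \<inter> B = swp j i (A \<inter> B)" using F by (auto simp: swp_def)
          moreover have "card (swp j i (A \<inter> B)) = card (A \<inter> B)"
            using F True Ai fB by (intro card_swp) auto
          ultimately show ?thesis using \<open>B \<in> \<C>\<close> by (intro bexI[of _ B]) auto
        next
          case False
          then have "swp j i A \<inter> B \<subseteq> A \<inter> B" by (auto simp: swp_def)
          then show ?thesis using \<open>B \<in> \<C>\<close> fB by (meson card_mono finite_Int)
        qed
      qed
      then show ?thesis using tm[OF A'] by (meson le_trans)
    qed
  qed
  show ?thesis unfolding pairwise_meet_def
    using one tm by (metis Int_commute)
qed

text \<open>Every effective shift towards \<open>v\<close> lowers the number of members without
  \<open>v\<close>, so shifting comes to an end.\<close>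

lemma stable_towards:
  fixes v :: 'a and \<C> :: "'a set set"
  assumes "finite \<C>" "\<And>C. C \<in> \<C> \<Longrightarrow> finite C \<and> card C = a"
  obtains \<D> where "finite \<D>" "\<And>C. C \<in> \<D> \<Longrightarrow> finite C \<and> card C = a" "card \<D> = card \<C>"
    "\<And>l. card (shad l \<D>) \<le> card (shad l \<C>)"
    "\<And>C j. C \<in> \<D> \<Longrightarrow> j \<in> C \<Longrightarrow> v \<notin> C \<Longrightarrow> swp v j C \<in> \<D>"
  using assms
proof (induction "card {C \<in> \<C>. v \<notin> C}" arbitrary: \<C> thesis rule: less_induct)
  case less
  show ?case
  proof (cases "\<forall>C\<in>\<C>. \<forall>j\<in>C. v \<notin> C \<longrightarrow> swp v j C \<in> \<C>")
    case True
    then show ?thesis using less.prems(1)[of \<C>] less.prems(2,3) by auto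
  next
    case False
    then obtain C j where C: "C \<in> \<C>" "j \<in> C" "v \<notin> C" "swp v j C \<notin> \<C>" by blast
    have vj: "v \<noteq> j" using C by auto
    have "{D \<in> shift v j \<C>. v \<notin> D} \<subset> {D \<in> \<C>. v \<notin> D}"
      using C by (auto simp: mem_shift[OF vj] split: if_splits)
    then have lt: "card {D \<in> shift v j \<C>. v \<notin> D} < card {D \<in> \<C>. v \<notin> D}"
      using less.prems(2) by (intro psubset_card_mono) auto
    obtain \<D> where D: "finite \<D>" "\<And>C. C \<in> \<D> \<Longrightarrow> finite C \<and> card C = a" "card \<D> = card (shift v j \<C>)"
      "\<And>l. card (shad l \<D>) \<le> card (shad l (shift v j \<C>))"
      "\<And>C j. C \<in> \<D> \<Longrightarrow> j \<in> C \<Longrightarrow> v \<notin> C \<Longrightarrow> swp v j C \<in> \<D>"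
      using less.hyps[OF lt] finite_shift[OF less.prems(2)] shift_uniform[OF less.prems(3)] by metis
    have "card (shad l \<D>) \<le> card (shad l \<C>)" for l
      using D(4)[of l] card_shad_shift[OF vj less.prems(2)] less.prems(3) le_trans by blast
    then show ?thesis using less.prems(1)[OF D(1,2)] D(3,5) by (simp add: card_shift)
  qed
qed

text \<open>Here the number of members containing \<open>v\<close> drops. Stability lets
  \<open>v\<close> be exchanged for any point outside a member, which frees intersections from
  \<open>v\<close>.\<close>

lemma stable_away:
  fixes v :: 'a and \<C> :: "'a set set"
  assumes "finite X" "\<C> \<subseteq> Pow X" "\<And>C. C \<in> \<C> \<Longrightarrow> card C = a" "pairwise_meet t \<C>"
  obtains \<D> where "\<D> \<subseteq> Pow X" "\<And>C. C \<in> \<D> \<Longrightarrow> card C = a" "pairwise_meet t \<D>" 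
    "card \<D> = card \<C>" "\<And>l. card (shad l \<D>) \<le> card (shad l \<C>)"
    "\<And>C x. C \<in> \<D> \<Longrightarrow> v \<in> C \<Longrightarrow> x \<in> X - C \<Longrightarrow> swp x v C \<in> \<D>"
  using assms
proof (induction "card {C \<in> \<C>. v \<in> C}" arbitrary: \<C> thesis rule: less_induct)
  case less
  have fin: "finite \<C>" "\<And>C. C \<in> \<C> \<Longrightarrow> finite C"
    using less.prems(2,3) by (auto intro: finite_subset[of _ "Pow X"] finite_subset[of _ X])
  show ?case
  proof (cases "\<forall>C\<in>\<C>. \<forall>x\<in>X - C. v \<in> C \<longrightarrow> swp x v C \<in> \<C>")
    case True
    then show ?thesis using less.prems(1)[of \<C>] less.prems(3-) by auto
  next
    case False
    then obtain C x where C: "C \<in> \<C>" "x \<in> X" "x \<notin> C" "v \<in> C" "swp x v C \<notin> \<C>" by blast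
    have xv: "x \<noteq> v" using C by auto
    have "{D \<in> shift x v \<C>. v \<in> D} \<subset> {D \<in> \<C>. v \<in> D}"
      using C by (auto simp: mem_shift[OF xv] split: if_splits)
    then have lt: "card {D \<in> shift x v \<C>. v \<in> D} < card {D \<in> \<C>. v \<in> D}"
      using fin(1) by (intro psubset_card_mono) auto
    have u: "card D = a" if "D \<in> shift x v \<C>" for D
      using shift_uniform[OF _ that, of a] less.prems(4) fin by blast
    obtain \<D> where D: "\<D> \<subseteq> Pow X" "\<And>C. C \<in> \<D> \<Longrightarrow> card C = a" "pairwise_meet t \<D>" 
      "card \<D> = card (shift x v \<C>)" "\<And>l. card (shad l \<D>) \<le> card (shad l (shift x v \<C>))"
      "\<And>C x. C \<in> \<D> \<Longrightarrow> v \<in> C \<Longrightarrow> x \<in> X - C \<Longrightarrow> swp x v C \<in> \<D>"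
      using less.hyps[OF lt _ less.prems(2) shift_subset_Pow[OF less.prems(3) C(2)] u
          pairwise_meet_shift[OF xv fin(2) less.prems(5)]] by metis
    have "card (shad l \<D>) \<le> card (shad l \<C>)" for l
      using D(5)[of l] card_shad_shift[OF xv fin] le_trans by blast
    then show ?thesis using less.prems(1)[OF D(1,2,3)] D(4,6) by (simp add: card_shift)
  qed
qed

section \<open>Shadow theorems\<close>

abbreviation link :: "'a \<Rightarrow> 'a set set \<Rightarrow> 'a set set" where
  "link v \<C> \<equiv> (\<lambda>C. C - {v}) ` {C \<in> \<C>. v \<in> C}"

abbreviation avoid :: "'a \<Rightarrow> 'a set set \<Rightarrow> 'a set set" where
  "avoid v \<C> \<equiv> {C \<in> \<C>. v \<notin> C}"

lemma card_link: "card (link v \<C>) = card {C \<in> \<C>. v \<in> C}"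
  by (rule card_image) (auto simp: inj_on_def)

lemma card_link_avoid:
  assumes "finite \<C>"
  shows "card \<C> = card (link v \<C>) + card (avoid v \<C>)"
proof -
  have "\<C> = {C \<in> \<C>. v \<in> C} \<union> avoid v \<C>" by blast
  moreover have "card ({C \<in> \<C>. v \<in> C} \<union> avoid v \<C>) = card {C \<in> \<C>. v \<in> C} + card (avoid v \<C>)"
    using assms by (intro card_Un_disjoint) auto
  ultimately show ?thesis by (simp add: card_link)
qed

text \<open>The shadow sets containing \<open>v\<close> include those obtained by adding
  \<open>v\<close> to the shadow of the link; they are disjoint from \<open>\<T>\<close>.\<close>

lemma card_shad_split:
  assumes "finite \<C>" "\<And>C. C \<in> \<C> \<Longrightarrow> finite C" "\<T> \<subseteq> shad (Suc l) \<C>" "\<And>B. B \<in> \<T> \<Longrightarrow> v \<notin> B"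
  shows "card \<T> + card (shad l (link v \<C>)) \<le> card (shad (Suc l) \<C>)"
proof -
  let ?I = "insert v ` shad l (link v \<C>)"
  have sub: "?I \<subseteq> shad (Suc l) \<C>"
    by (auto simp: shad_def card_insert_if)
  have "inj_on (insert v) (shad l (link v \<C>))"
    by (rule inj_onI, rule insert_ident[THEN iffD1]) (auto simp: shad_def)
  then have "card (shad l (link v \<C>)) = card ?I" by (simp add: card_image)
  moreover have "card (\<T> \<union> ?I) = card \<T> + card ?I"
    using assms finite_shad[of \<C> "Suc l"] sub
    by (intro card_Un_disjoint) (auto intro: finite_subset)
  moreover have "card (\<T> \<union> ?I) \<le> card (shad (Suc l) \<C>)"
    using sub assms(3) by (intro card_mono finite_shad assms) auto
  ultimately show ?thesis by simp
qed

text \<open>Lovasz's form for integral \<open>x\<close>. After shifting towards \<open>v\<close>,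
  the link of \<open>v\<close> contains the shadow of the members avoiding \<open>v\<close>; the
  link and its own shadow then add up by Pascal's rule.\<close>

lemma kruskal_katona_step:
  assumes "finite \<C>" "\<And>C. C \<in> \<C> \<Longrightarrow> finite C \<and> card C = Suc a"
    and "Suc a \<le> x" "x choose Suc a \<le> card \<C>"
  shows "x choose a \<le> card (shad a \<C>)"
  using assms
proof (induction x arbitrary: a \<C>)
  case 0
  then show ?case by simp
next
  case (Suc x)
  have "0 < card \<C>" using Suc.prems(3,4) by (meson less_le_trans zero_less_binomial)
  then obtain C0 where C0: "C0 \<in> \<C>" by fastforce
  show ?case
  proof (cases a)
    case 0
    have "{} \<in> shad 0 \<C>" using C0 by (auto simp: shad_def)
    moreover have "finite (shad 0 \<C>)" using Suc.prems by (intro finite_shad) auto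
    ultimately have "0 < card (shad 0 \<C>)" by (auto simp: card_gt_0_iff)
    then show ?thesis using 0 by simp
  next
    case (Suc b)
    obtain v where "v \<in> C0" using Suc.prems(2)[OF C0] by fastforce
    obtain \<D> where D: "finite \<D>" "\<And>C. C \<in> \<D> \<Longrightarrow> finite C \<and> card C = Suc a" "card \<D> = card \<C>"
      "\<And>l. card (shad l \<D>) \<le> card (shad l \<C>)"
      "\<And>C j. C \<in> \<D> \<Longrightarrow> j \<in> C \<Longrightarrow> v \<notin> C \<Longrightarrow> swp v j C \<in> \<D>"
      using stable_towards[OF Suc.prems(1,2)] by metis
    have fD: "finite C" if "C \<in> \<D>" for C using D(2) that by blast
    have lk: "finite (link v \<D>)" "\<And>C. C \<in> link v \<D> \<Longrightarrow> finite C \<and> card C = a"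
      using D(1,2) by auto
    have sh: "shad a (avoid v \<D>) \<subseteq> link v \<D>"
    proof
      fix B assume "B \<in> shad a (avoid v \<D>)"
      then obtain C where B: "finite B" "card B = a" "B \<subseteq> C" and C: "C \<in> \<D>" "v \<notin> C"
        unfolding shad_def by blast
      have "card (C - B) = 1" using B C D(2) by (subst card_Diff_subset) auto
      then obtain j where j: "C - B = {j}" using card_1_singletonE by blast
      then have "swp v j C = insert v B" using B(3) by (auto simp: swp_def)
      moreover have "swp v j C \<in> \<D>" using D(5)[OF C(1) _ C(2)] j by blast
      moreover have "B = insert v B - {v}" using B(3) C(2) by auto
      ultimately show "B \<in> link v \<D>" by (metis (mono_tags, lifting) image_eqI insertI1 mem_Collect_eq)
    qed
    have sum: "card \<C> = card (link v \<D>) + card (avoid v \<D>)"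
      using card_link_avoid[OF D(1)] D(3) by metis
    \<comment> \<open>A smaller link would leave more than \<open>x choose Suc a\<close> members
      avoiding \<open>v\<close>, whose shadow lies in the link and is too large for it.\<close>
    have "x choose a \<le> card (link v \<D>)"
    proof (rule ccontr)
      assume small: "\<not> ?thesis"
      then have av: "x choose Suc a < card (avoid v \<D>)"
        using Suc.prems(4) sum by simp
      then have "avoid v \<D> \<noteq> {}" by (metis card.empty not_less_zero)
      then obtain C where C: "C \<in> avoid v \<D>" by blast
      have "x choose a \<le> card (shad a (avoid v \<D>))"
      proof (cases "Suc a \<le> x")
        case True
        show ?thesis using Suc.IH[of "avoid v \<D>" a] D(1,2) True av by auto
      next
        case False
        \<comment> \<open>Here \<open>x\<close> is too small for the induction hypothesis, but a
          single member already has a nonempty shadow and \<open>a choose a\<close> is 1.\<close>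
        then have "x = a" using Suc.prems(3) by simp
        then have "x choose a \<le> 1" by simp
        obtain B where "B \<subseteq> C" "card B = a" "finite B"
          using C D(2) obtain_subset_with_card_n[of a C] by (metis (no_types, lifting) finite_subset le_SucI mem_Collect_eq order_refl)
        then have "B \<in> shad a (avoid v \<D>)" using C unfolding shad_def by blast
        then have "0 < card (shad a (avoid v \<D>))" using D(1) fD finite_shad[of "avoid v \<D>"]
          by (auto simp: card_gt_0_iff)
        then show ?thesis using \<open>x choose a \<le> 1\<close> by simp
      qed
      also have "\<dots> \<le> card (link v \<D>)" using sh lk(1) by (rule card_mono[rotated])
      finally show False using small by simp
    qed
    moreover have "x choose b \<le> card (shad b (link v \<D>))"
      using Suc.IH[OF lk(1), of b] lk(2) Suc Suc.prems(3) calculation by auto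
    moreover have "link v \<D> \<subseteq> shad a \<D>"
      using lk(2) by (auto simp: shad_def)
    then have "card (link v \<D>) + card (shad b (link v \<D>)) \<le> card (shad a \<D>)"
      unfolding Suc by (intro card_shad_split D(1) fD) auto
    ultimately show ?thesis using D(4)[of a] Suc by simp
  qed
qed

lemma kruskal_katona_lovasz:
  assumes "finite \<C>" "\<And>C. C \<in> \<C> \<Longrightarrow> finite C \<and> card C = a"
    and "l \<le> a" "a \<le> x" "x choose a \<le> card \<C>"
  shows "x choose l \<le> card (shad l \<C>)"
  using \<open>l \<le> a\<close>
proof (induction l rule: inc_induct)
  case base
  have "shad a \<C> = \<C>"
    using assms(2) unfolding shad_def by auto (metis card_subset_eq)
  then show ?case using assms(5) by simp
next
  case (step m)
  have fin: "finite (shad (Suc m) \<C>)" using assms(1,2) by (intro finite_shad) auto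
  have "shad m (shad (Suc m) \<C>) \<subseteq> shad m \<C>" unfolding shad_def by blast
  then have "card (shad m (shad (Suc m) \<C>)) \<le> card (shad m \<C>)"
    using assms(1,2) by (intro card_mono finite_shad) auto
  moreover have "x choose m \<le> card (shad m (shad (Suc m) \<C>))"
  proof (rule kruskal_katona_step[OF fin])
    show "finite C \<and> card C = Suc m" if "C \<in> shad (Suc m) \<C>" for C
      using that by (simp add: shad_def)
  qed (use step assms(4) in simp_all)
  ultimately show ?case by simp
qed

section \<open>Cross-intersecting families and shadows of t-intersecting families\<close>

lemma card_subsets: "finite V \<Longrightarrow> card {G. G \<subseteq> V \<and> card G = k} = card V choose k"
  using n_subsets by blast

text \<open>An \<open>a\<close>-set inside a complement \<open>W - X\<close> is disjoint from
  \<open>X\<close>, hence not in \<open>\<A>\<close>; Kruskal--Katona makes the shadow of the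
  complements large. The bound on \<open>card \<H>\<close> is the number of \<open>k\<close>-sets
  through \<open>t\<close> given points.\<close>

lemma cross_intersecting_bound:
  assumes W: "finite W" "card W = m"
    and H: "\<And>X. X \<in> \<H> \<Longrightarrow> X \<subseteq> W \<and> card X = k"
    and A: "\<And>X. X \<in> \<A> \<Longrightarrow> X \<subseteq> W \<and> card X = a"
    and cross: "\<And>X Y. X \<in> \<H> \<Longrightarrow> Y \<in> \<A> \<Longrightarrow> X \<inter> Y \<noteq> {}"
    and ka: "k + a \<le> m" and t: "t \<le> k" "m - t choose (k - t) \<le> card \<H>"
  shows "card \<A> + (m - t choose a) \<le> m choose a"
proof -
  let ?C = "(\<lambda>X. W - X) ` \<H>"
  have "inj_on (\<lambda>X. W - X) \<H>" using H by (intro inj_onI) blast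
  then have "card ?C = card \<H>" by (rule card_image)
  moreover have "m - t choose (m - k) = m - t choose (k - t)"
    using binomial_symmetric[of "k - t" "m - t"] t ka by simp
  moreover have fH: "finite \<H>" using H W by (auto intro: finite_subset[of _ "Pow W"])
  moreover have "finite C \<and> card C = m - k" if "C \<in> ?C" for C
    using that H W by (auto simp: card_Diff_subset[OF finite_subset[OF _ W(1)]])
  ultimately have "m - t choose a \<le> card (shad a ?C)"
    using t ka by (intro kruskal_katona_lovasz[of ?C "m - k"]) auto
  moreover have "shad a ?C \<inter> \<A> = {}" using cross A unfolding shad_def by blast
  moreover have "shad a ?C \<union> \<A> \<subseteq> {G. G \<subseteq> W \<and> card G = a}"
    using A unfolding shad_def by auto
  moreover have "finite {G. G \<subseteq> W \<and> card G = a}" using W by simp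
  ultimately have "card (shad a ?C) + card \<A> \<le> m choose a"
    using card_Un_disjoint[of "shad a ?C" \<A>] card_mono card_subsets[OF W(1), of a] W(2)
    by (metis (no_types, lifting) finite_Un finite_subset)
  then show ?thesis using \<open>m - t choose a \<le> card (shad a ?C)\<close> by simp
qed

lemma sum_card_double_count:
  assumes "finite A" "finite B"
  shows "(\<Sum>a\<in>A. card {b \<in> B. R a b}) = (\<Sum>b\<in>B. card {a \<in> A. R a b})"
proof -
  have "(\<Sum>a\<in>A. card {b \<in> B. R a b}) = (\<Sum>a\<in>A. \<Sum>b\<in>B. if R a b then 1 else 0)"
    using assms by (simp flip: sum.inter_filter)
  also have "\<dots> = (\<Sum>b\<in>B. \<Sum>a\<in>A. if R a b then 1 else 0)" by (rule sum.swap)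
  also have "\<dots> = (\<Sum>b\<in>B. card {a \<in> A. R a b})"
    using assms by (simp flip: sum.inter_filter)
  finally show ?thesis .
qed

lemma card_supersets:
  assumes "finite V" "S \<subseteq> V"
  shows "card {G. S \<subseteq> G \<and> G \<subseteq> V \<and> card G = k} \<le> card V - card S choose (k - card S)"
proof -
  have fS: "finite S" using assms finite_subset by blast
  have "card {G. S \<subseteq> G \<and> G \<subseteq> V \<and> card G = k} \<le> card {G. G \<subseteq> V - S \<and> card G = k - card S}"
  proof (rule card_inj_on_le[of "\<lambda>G. G - S"])
    show "inj_on (\<lambda>G. G - S) {G. S \<subseteq> G \<and> G \<subseteq> V \<and> card G = k}" by (rule inj_onI) blast
  qed (use assms fS in \<open>auto simp: card_Diff_subset\<close>)
  also have "\<dots> = card V - card S choose (k - card S)"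
    using assms fS by (simp add: card_subsets card_Diff_subset)
  finally show ?thesis .
qed

lemma binomial_diff_three: "Suc (m + 2) choose Suc a \<le> (m choose Suc a) + 3 * (m + 2 choose a)"
proof -
  have "Suc m choose a \<le> m + 2 choose a" "m choose a \<le> m + 2 choose a"
    by (auto intro!: binomial_right_mono)
  then show ?thesis by (simp add: eval_nat_numeral)
qed

text \<open>Once the family has been shifted away from \<open>v\<close> and the ground set is large, the link of \<open>v\<close>
  is still \<open>t\<close>-intersecting, so \<open>v\<close> can be removed; small ground sets need only double counting.\<close>
lemma katona_intersecting_shadow:
  assumes "finite X" "\<C> \<subseteq> Pow X" "\<And>C. C \<in> \<C> \<Longrightarrow> card C = a" "pairwise_meet t \<C>"
    and "1 \<le> t" "t \<le> a"
  shows "a * card \<C> \<le> (a - t + 1) * card (shad (a - t + 1) \<C>)"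
  using assms
proof (induction "card X" arbitrary: X \<C> a rule: less_induct)
  case less
  let ?l = "a - t + 1"
  have fin: "finite \<C>" "\<And>C. C \<in> \<C> \<Longrightarrow> finite C"
    using less.prems(1,2) by (auto intro: finite_subset[of _ "Pow X"] finite_subset[of _ X])
  show ?case
  proof (cases "card X \<le> 2 * a - t")
    case True
    let ?S = "shad ?l \<C>"
    have fS: "finite ?S" by (rule finite_shad[OF fin])
    have la: "?l \<le> a" using less.prems(5,6) by simp
    \<comment> \<open>Double counting of the pairs \<open>B \<subseteq> C\<close>. Each
      \<open>B\<close> extends to few members because \<open>card X - ?l \<le> a - 1\<close> in this
      case.\<close>
    have "card \<C> * (a choose ?l) = (\<Sum>C\<in>\<C>. card {B \<in> ?S. B \<subseteq> C})"
    proof -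
      have "card {B \<in> ?S. B \<subseteq> C} = a choose ?l" if "C \<in> \<C>" for C
      proof -
        have "{B \<in> ?S. B \<subseteq> C} = {B. B \<subseteq> C \<and> card B = ?l}"
          using that fin(2) unfolding shad_def by (auto intro: finite_subset)
        then show ?thesis using card_subsets[OF fin(2)[OF that]] less.prems(3)[OF that] by simp
      qed
      then show ?thesis by simp
    qed
    also have "\<dots> = (\<Sum>B\<in>?S. card {C \<in> \<C>. B \<subseteq> C})"
      by (rule sum_card_double_count[OF fin(1) fS])
    also have "\<dots> \<le> (\<Sum>B\<in>?S. a - 1 choose (a - ?l))"
    proof (rule sum_mono)
      fix B assume "B \<in> ?S"
      then have B: "B \<subseteq> X" "card B = ?l" using less.prems(2) unfolding shad_def by auto
      have "card {C \<in> \<C>. B \<subseteq> C} \<le> card {G. B \<subseteq> G \<and> G \<subseteq> X \<and> card G = a}"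
        using less.prems(1-3) by (intro card_mono) auto
      also have "\<dots> \<le> card X - ?l choose (a - ?l)"
        using card_supersets[OF less.prems(1) B(1)] B(2) by metis
      also have "\<dots> \<le> a - 1 choose (a - ?l)"
        using True less.prems(5,6) by (intro binomial_right_mono) simp
      finally show "card {C \<in> \<C>. B \<subseteq> C} \<le> a - 1 choose (a - ?l)" .
    qed
    finally have le: "card \<C> * (a choose ?l) \<le> card ?S * (a - 1 choose (a - ?l))" by simp
    have "a * (a - 1 choose (a - ?l)) = a * (a - 1 choose (?l - 1))"
      using la binomial_symmetric[of "?l - 1" "a - 1"] less.prems(5,6) by (simp add: diff_diff_eq)
    also have "\<dots> = ?l * (a choose ?l)"
      using Suc_times_binomial_eq[of "a - 1" "a - t"] less.prems(5,6) by (simp add: mult.commute)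
    finally have e: "a * (a - 1 choose (a - ?l)) = ?l * (a choose ?l)" .
    have "(a * card \<C>) * (a choose ?l) \<le> a * (card ?S * (a - 1 choose (a - ?l)))"
      using mult_le_mono2[OF le, of a] by (simp only: mult.assoc)
    also have "\<dots> = (?l * card ?S) * (a choose ?l)"
      using arg_cong[OF e, of "\<lambda>z. card ?S * z"] by (simp only: mult_ac)
    finally show ?thesis using la by (subst (asm) mult_le_cancel2) (auto simp: zero_less_binomial_iff)
  next
    case False
    then have "X \<noteq> {}" by auto
    then obtain v where v: "v \<in> X" by blast
    obtain \<D> where D: "\<D> \<subseteq> Pow X" "\<And>C. C \<in> \<D> \<Longrightarrow> card C = a" "pairwise_meet t \<D>" 
      "card \<D> = card \<C>" "\<And>l. card (shad l \<D>) \<le> card (shad l \<C>)"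
      "\<And>C x. C \<in> \<D> \<Longrightarrow> v \<in> C \<Longrightarrow> x \<in> X - C \<Longrightarrow> swp x v C \<in> \<D>"
      using stable_away[OF less.prems(1-4)] by metis
    have fD: "finite \<D>" "\<And>C. C \<in> \<D> \<Longrightarrow> finite C"
      using less.prems(1) D(1) by (auto intro: finite_subset[of _ "Pow X"] finite_subset[of _ X])
    have lt: "card (X - {v}) < card X" using v less.prems(1) by (intro psubset_card_mono) auto
    \<comment> \<open>Since \<open>card (A \<union> B) \<le> 2 * a - t < card X\<close>, some
      \<open>x\<close> lies outside both sets. Exchanging \<open>v\<close> for \<open>x\<close> in
      \<open>A\<close> yields a member that meets \<open>B\<close> in
      \<open>A \<inter> B - {v}\<close>.\<close>
    have meet: "t \<le> card (A \<inter> B - {v})" if AB: "A \<in> \<D>" "B \<in> \<D>" "v \<in> A" "v \<in> B" for A B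
    proof -
      have "card (A \<union> B) + card (A \<inter> B) = 2 * a"
        using card_Un_Int[of A B] AB D(2) fD(2) by (simp add: mult_2)
      moreover have "t \<le> card (A \<inter> B)" using D(3) AB unfolding pairwise_meet_def by blast
      ultimately have "card (A \<union> B) < card X" using False by simp
      moreover have "A \<union> B \<subseteq> X" using AB D(1) by blast
      ultimately obtain x where x: "x \<in> X" "x \<notin> A" "x \<notin> B" by (metis UnI1 UnI2 nat_less_le subsetI subset_antisym)
      then have "swp x v A \<in> \<D>" using D(6) AB by blast
      then have "t \<le> card (swp x v A \<inter> B)" using D(3) AB unfolding pairwise_meet_def by blast
      moreover have "swp x v A \<inter> B = A \<inter> B - {v}" using x by (auto simp: swp_def)
      ultimately show ?thesis by simp
    qed
    have IH1: "a * card (avoid v \<D>) \<le> ?l * card (shad ?l (avoid v \<D>))"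
      using D(1-3) less.prems(1,5,6) by (intro less.hyps[OF lt]) (auto simp: pairwise_meet_def)
    have IH2: "a * card (link v \<D>) \<le> ?l * card (shad (a - t) (link v \<D>))"
    proof (cases "link v \<D> = {}")
      case ne: False
      then obtain C where C: "C \<in> \<D>" "v \<in> C" by blast
      have "card (C \<inter> C - {v}) < a" using C D(2) fD(2) by (metis Int_absorb card_Diff1_less)
      then have ta: "t \<le> a - 1" using meet[OF C(1,1,2,2)] by simp
      have "pairwise_meet t (link v \<D>)"
        unfolding pairwise_meet_def using meet by (auto simp: Int_Diff Diff_Int_distrib2)
      then have "(a - 1) * card (link v \<D>) \<le> (a - 1 - t + 1) * card (shad (a - 1 - t + 1) (link v \<D>))"
        using D(1,2) fD(2) less.prems(1,5) ta by (intro less.hyps[OF lt]) auto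
      moreover have "a - 1 - t + 1 = a - t" using ta less.prems(5,6) by simp
      ultimately have h: "(a - 1) * card (link v \<D>) \<le> (a - t) * card (shad (a - t) (link v \<D>))"
        by (simp only:)
      define p where "p = card (link v \<D>)"
      define q where "q = card (shad (a - t) (link v \<D>))"
      \<comment> \<open>The link gives the ratio of \<open>a - 1\<close> to \<open>a - t\<close>,
        and the ratio of \<open>a\<close> to \<open>a - t + 1\<close> is no larger because
        \<open>t \<ge> 1\<close>. The variable \<open>b\<close> removes the subtractions from this
        comparison.\<close>
      have b: "a = (a - t - 1) + t + 1" using ta less.prems(5,6) by simp
      define b where "b = a - t - 1"
      note b = b[folded b_def]
      have at: "a - 1 = b + t" "a - t = b + 1" using b by simp_all
      have "(b + t) * p \<le> (b + 1) * q" using h unfolding at by (simp only: p_def q_def at)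
      then have "(b + 2) * ((b + t) * p) \<le> (b + 1) * ((b + 2) * q)"
        by (metis mult.left_commute mult_le_mono2)
      moreover have "(b + 1) * ((b + t + 1) * p) \<le> (b + 2) * ((b + t) * p)"
        using less.prems(5) by (simp add: algebra_simps)
      ultimately have "(b + 1) * ((b + t + 1) * p) \<le> (b + 1) * ((b + 2) * q)" by linarith
      then have "(b + t + 1) * p \<le> (b + 2) * q" by (subst (asm) mult_le_cancel1) simp
      moreover have "a = b + t + 1" "?l = b + 2" using b by simp_all
      ultimately show ?thesis unfolding p_def q_def by (simp only:)
    next
      case True
      then show ?thesis by (simp only: card.empty mult_0_right le0)
    qed
    have "card (shad ?l (avoid v \<D>)) + card (shad (a - t) (link v \<D>)) \<le> card (shad ?l \<D>)"
      unfolding Suc_eq_plus1[symmetric]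
      by (rule card_shad_split[OF fD]) (auto simp: shad_def)
    then have "?l * card (shad ?l (avoid v \<D>)) + ?l * card (shad (a - t) (link v \<D>)) \<le> ?l * card (shad ?l \<C>)"
      using mult_le_mono2[OF le_trans[OF _ D(5)[of ?l]]] by (simp only: add_mult_distrib2[symmetric])
    moreover have "a * card \<C> = a * card (link v \<D>) + a * card (avoid v \<D>)"
      using card_link_avoid[OF fD(1), of v] D(4) by (simp only: add_mult_distrib2[symmetric])
    ultimately show ?thesis using IH1 IH2 by linarith
  qed
qed

text \<open>Complements of members meet in at least \<open>card V - u\<close> points, and the sets
  below a complement are those disjoint from the member, so Katona's theorem applies to the
  complements.\<close>

lemma disjoint_family_bound:
  assumes V: "finite V" and A: "\<And>A. A \<in> \<A> \<Longrightarrow> A \<subseteq> V \<and> card A = b"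
    and un: "\<And>A B. A \<in> \<A> \<Longrightarrow> B \<in> \<A> \<Longrightarrow> card (A \<union> B) \<le> u" and u: "b \<le> u" "u < card V"
  shows "(card V - b) * card \<A> \<le>
    (u + 1 - b) * card {B. B \<subseteq> V \<and> card B = u + 1 - b \<and> (\<exists>A\<in>\<A>. A \<inter> B = {})}"
proof -
  let ?C = "(\<lambda>X. V - X) ` \<A>"
  have "inj_on (\<lambda>X. V - X) \<A>" using A by (intro inj_onI) blast
  then have cC: "card ?C = card \<A>" by (rule card_image)
  have l: "(card V - b) - (card V - u) + 1 = u + 1 - b" using u by simp
  have "(card V - b) * card ?C \<le> ((card V - b) - (card V - u) + 1) * card (shad ((card V - b) - (card V - u) + 1) ?C)"
  proof (rule katona_intersecting_shadow[OF V])
    show "card C = card V - b" if "C \<in> ?C" for C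
      using that A V by (auto simp: card_Diff_subset[OF finite_subset[OF _ V]])
    show "pairwise_meet (card V - u) ?C" unfolding pairwise_meet_def
    proof (intro ballI)
      fix C D assume "C \<in> ?C" "D \<in> ?C"
      then obtain A B where AB: "A \<in> \<A>" "B \<in> \<A>" "C = V - A" "D = V - B" by blast
      then have "C \<inter> D = V - (A \<union> B)" by blast
      moreover have "A \<union> B \<subseteq> V" using AB A by blast
      ultimately show "card V - u \<le> card (C \<inter> D)"
        using un[OF AB(1,2)] card_Diff_subset[OF finite_subset[OF _ V], of "A \<union> B"] by simp
    qed
  qed (use u in auto)
  moreover have "shad (u + 1 - b) ?C = {B. B \<subseteq> V \<and> card B = u + 1 - b \<and> (\<exists>A\<in>\<A>. A \<inter> B = {})}"
    using V unfolding shad_def by (auto intro: finite_subset)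
  ultimately show ?thesis unfolding l cC by simp
qed

section \<open>The diversity of an intersecting family\<close>

text \<open>With \<open>k = s + 1\<close> both bounds follow from those in (ii):
  \<open>4 * (s + 1) * (s + 3)\<close> is below \<open>4 * (s + 2)^2\<close>, and
  \<open>k + 6 = s + 7\<close>.\<close>

locale intersecting_family =
  fixes V :: "'a set" and \<G> :: "'a set set" and k :: nat
  assumes finite_V: "finite V"
    and uniform: "\<And>G. G \<in> \<G> \<Longrightarrow> G \<subseteq> V \<and> card G = k"
    and meet: "\<And>G H. G \<in> \<G> \<Longrightarrow> H \<in> \<G> \<Longrightarrow> G \<inter> H \<noteq> {}"
    and k_ge: "3 \<le> k"
    and quadratic_bound: "4 * k * (k + 2) \<le> card V"
    and linear_bound: "36 * (k + 6) \<le> card V"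
begin

abbreviation n where "n \<equiv> card V"

text \<open>Thresholds below are multiples of \<open>q\<close>, the number of \<open>k\<close>-sets through three given points: a set \<open>S\<close>
  missed by at least \<open>q\<close> members lies, by Kruskal--Katona, in at most as many members as if all
  members missing \<open>S\<close> contained three common points.\<close>
definition q where "q = n - 3 choose (k - 3)"

definition up where "up S = {G \<in> \<G>. S \<subseteq> G}"

definition off where "off S = {G \<in> \<G>. G \<inter> S = {}}"

lemma finite_family: "finite \<G>"
  using uniform finite_V by (auto intro: finite_subset[of _ "Pow V"])

lemma finite_member: "G \<in> \<G> \<Longrightarrow> finite G"
  using uniform finite_V finite_subset by blast

lemma finite_up_off [simp]: "finite (up S)" "finite (off S)"
  using finite_family by (auto simp: up_def off_def)

lemma k_less_n: "2 * k < n"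
  using linear_bound by (simp add: distrib_left)

lemma q_pos: "0 < q"
  using k_less_n by (auto simp: q_def zero_less_binomial_iff)

lemma card_up_le:
  assumes "S \<subseteq> V" shows "card (up S) \<le> n - card S choose (k - card S)"
proof -
  have "card (up S) \<le> card {G. S \<subseteq> G \<and> G \<subseteq> V \<and> card G = k}"
    using uniform finite_V by (intro card_mono) (auto simp: up_def)
  then show ?thesis using card_supersets[OF finite_V assms] le_trans by blast
qed

text \<open>The gain from one more prescribed point: the ratio is \<open>k - r\<close> to
  \<open>n - r\<close>, and \<open>n - r\<close> is at least \<open>4 * k * k\<close>.\<close>

lemma binomial_ratio:
  assumes "r < k" shows "4 * k * (n - Suc r choose (k - Suc r)) \<le> n - r choose (k - r)"
proof -
  obtain m where m: "n - r = Suc m" using assms k_less_n by (metis Suc_diff_Suc diff_less_mono2 less_imp_diff_less mult_2 add_lessD1 less_trans)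
  obtain j where j: "k - r = Suc j" using assms by (metis Suc_diff_Suc)
  have e: "Suc j * (Suc m choose Suc j) = Suc m * (m choose j)" by (rule Suc_times_binomial)
  have "4 * k * Suc j \<le> 4 * k * k" using j by (intro mult_le_mono2) simp
  moreover have "4 * k * k + k \<le> n" using quadratic_bound by (simp add: algebra_simps)
  ultimately have "4 * k * Suc j \<le> Suc m" using m assms by linarith
  then have "4 * k * Suc j * (m choose j) \<le> Suc m * (m choose j)" by (rule mult_le_mono1)
  then have "Suc j * (4 * k * (m choose j)) \<le> Suc j * (Suc m choose Suc j)"
    unfolding e by (simp only: mult_ac)
  then have "4 * k * (m choose j) \<le> Suc m choose Suc j" by (subst (asm) mult_le_cancel1) simp
  moreover have "n - Suc r = m" "k - Suc r = j" using m j by auto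
  ultimately show ?thesis using m j by simp
qed

text \<open>Inside \<open>V - S\<close>, the members missing \<open>S\<close> cross-intersect the
  members containing \<open>S\<close> with \<open>S\<close> removed. As \<open>q\<close> bounds the
  number of \<open>k\<close>-sets of \<open>V - S\<close> through three given points, the
  cross-intersecting bound applies with \<open>t = 3\<close>.\<close>

lemma card_up_le_far:
  assumes S: "S \<subseteq> V" "card S < k" and far: "q \<le> card (off S)"
  shows "card (up S) \<le> 3 * (n - Suc (card S) choose (k - Suc (card S)))"
proof -
  let ?r = "card S"
  have fS: "finite S" using S finite_V finite_subset by blast
  have inj: "inj_on (\<lambda>G. G - S) (up S)" by (rule inj_onI) (auto simp: up_def)
  have W: "card (V - S) = n - ?r" using fS S by (simp add: card_Diff_subset)
  obtain a where a: "k - ?r = Suc a" using S(2) by (metis Suc_diff_Suc)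
  obtain m where m: "n - ?r = Suc (m + 2)"
  proof
    show "n - ?r = Suc ((n - ?r - 3) + 2)" using S(2) k_less_n k_ge by linarith
  qed
  have "card ((\<lambda>G. G - S) ` up S) + (n - ?r - 3 choose (k - ?r)) \<le> n - ?r choose (k - ?r)"
  proof (rule cross_intersecting_bound[OF _ W, of "off S" k])
    show "X \<subseteq> V - S \<and> card X = k" if "X \<in> off S" for X
      using that uniform by (auto simp: off_def)
    show "X \<subseteq> V - S \<and> card X = k - ?r" if "X \<in> (\<lambda>G. G - S) ` up S" for X
      using that uniform fS by (auto simp: up_def card_Diff_subset)
    show "X \<inter> Y \<noteq> {}" if "X \<in> off S" "Y \<in> (\<lambda>G. G - S) ` up S" for X Y
    proof -
      obtain G where "G \<in> \<G>" "Y = G - S" using \<open>Y \<in> _\<close> unfolding up_def by blast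
      moreover have "X \<in> \<G>" "X \<inter> S = {}" using that by (auto simp: off_def)
      ultimately show ?thesis using meet[of X G] by blast
    qed
    show "k + (k - ?r) \<le> n - ?r" using k_less_n S(2) by linarith
    have "n - ?r - 3 choose (k - 3) \<le> n - 3 choose (k - 3)" by (rule binomial_right_mono) simp
    then show "n - ?r - 3 choose (k - 3) \<le> card (off S)" using far unfolding q_def by linarith
  qed (use finite_V k_ge in auto)
  then have "card (up S) + (m choose Suc a) \<le> Suc (m + 2) choose Suc a"
    using m a by (simp add: card_image[OF inj])
  moreover have "Suc (m + 2) choose Suc a \<le> (m choose Suc a) + 3 * (m + 2 choose a)"
    by (rule binomial_diff_three)
  moreover have "n - Suc ?r = m + 2" "k - Suc ?r = a" using m a by auto
  ultimately show ?thesis by simp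
qed

lemma card_UN_up_le:
  assumes "finite I" "\<A> \<subseteq> (\<Union>i\<in>I. up (f i))"
  shows "card \<A> \<le> (\<Sum>i\<in>I. card (up (f i)))"
proof -
  have "card \<A> \<le> card (\<Union>i\<in>I. up (f i))" using assms by (intro card_mono) auto
  also have "\<dots> \<le> (\<Sum>i\<in>I. card (up (f i)))" by (rule card_UN_le[OF assms(1)])
  finally show ?thesis .
qed

text \<open>A member containing \<open>S\<close> has to meet \<open>G\<close>, and does so outside
  \<open>S\<close>.\<close>

lemma branch:
  assumes "G \<in> off S"
  shows "card (up S) \<le> (\<Sum>y\<in>G. card (up (insert y S)))"
proof (rule card_UN_up_le)
  show "finite G" using assms finite_member by (auto simp: off_def)
  show "up S \<subseteq> (\<Union>y\<in>G. up (insert y S))"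
  proof
    fix H assume "H \<in> up S"
    then have H: "H \<in> \<G>" "S \<subseteq> H" by (auto simp: up_def)
    then obtain y where "y \<in> G" "y \<in> H" using meet[of G H] assms by (auto simp: off_def)
    then show "H \<in> (\<Union>y\<in>G. up (insert y S))" using H by (auto simp: up_def)
  qed
qed

lemma power_binomial_le:
  assumes "3 + i \<le> k" shows "(4 * k) ^ i * (n - (3 + i) choose (k - (3 + i))) \<le> q"
  using assms
proof (induction i)
  case (Suc i)
  have "(4 * k) ^ Suc i * (n - (3 + Suc i) choose (k - (3 + Suc i)))
      = (4 * k) ^ i * (4 * k * (n - Suc (3 + i) choose (k - Suc (3 + i))))" by simp
  also have "\<dots> \<le> (4 * k) ^ i * (n - (3 + i) choose (k - (3 + i)))"
    using Suc.prems by (intro mult_le_mono2 binomial_ratio) simp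
  also have "\<dots> \<le> q" using Suc by simp
  finally show ?case .
qed (simp add: q_def)

end

section \<open>Families violating both alternatives of the dichotomy\<close>

locale spread_family = intersecting_family +
  assumes spread: "\<And>x. x \<in> V \<Longrightarrow> (n - k) * q \<le> k * card (off {x})"
    and no_triangle: "\<And>a b c. {a, b, c} \<subseteq> V \<Longrightarrow> a \<noteq> b \<Longrightarrow> a \<noteq> c \<Longrightarrow> b \<noteq> c \<Longrightarrow>
      \<exists>G\<in>\<G>. (a \<notin> G \<and> b \<notin> G) \<or> (a \<notin> G \<and> c \<notin> G) \<or> (b \<notin> G \<and> c \<notin> G)"
begin

lemma off_ge: assumes "x \<in> V" shows "4 * (k * q) + 7 * q \<le> card (off {x})"
proof -
  have "k * (4 * k + 7) \<le> n - k" using quadratic_bound by (simp add: algebra_simps)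
  then have "k * (4 * k + 7) * q \<le> (n - k) * q" by (rule mult_le_mono1)
  also have "\<dots> \<le> k * card (off {x})" using spread assms by simp
  finally have "k * ((4 * k + 7) * q) \<le> k * card (off {x})" by (simp only: mult.assoc)
  then have "(4 * k + 7) * q \<le> card (off {x})" using k_ge by (subst (asm) mult_le_cancel1) simp
  then show ?thesis by (simp add: algebra_simps)
qed

text \<open>The constants are those needed for near triples: \<open>84 * q + 9 * (k * q)\<close>
  from three degrees and \<open>4 * q\<close> from the members missing the triple. Large
  \<open>k\<close> follows from the quadratic bound, small \<open>k\<close> from the linear
  one.\<close>

lemma off_gt: assumes "x \<in> V" shows "88 * q + 9 * (k * q) < 4 * card (off {x})"
proof (cases "9 \<le> k")
  case True
  then have "9 * q \<le> k * q" by simp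
  then show ?thesis using off_ge[OF assms] q_pos by linarith
next
  case False
  \<comment> \<open>For \<open>k \<le> 8\<close>,
    \<open>n - k \<ge> 35 * k + 216 \<ge> 62 * k\<close>.\<close>
  then have "k * 62 \<le> n - k" using linear_bound by (simp add: distrib_left)
  then have "k * 62 * q \<le> (n - k) * q" by (rule mult_le_mono1)
  also have "\<dots> \<le> k * card (off {x})" using spread assms by simp
  finally have "k * (62 * q) \<le> k * card (off {x})" by (simp only: mult.assoc)
  then have "62 * q \<le> card (off {x})" using k_ge by (subst (asm) mult_le_cancel1) simp
  moreover have "k * q \<le> 8 * q" using False by simp
  ultimately show ?thesis using q_pos by linarith
qed

section \<open>Near pairs: two points missed together by fewer than \<open>6 * q\<close>
  members\<close>

lemma off_nonempty: "0 < card (off S) \<Longrightarrow> \<exists>G. G \<in> off S"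
  by (metis card.empty ex_in_conv less_irrefl)

lemma card_up2_le: assumes "x \<in> V" "y \<in> V" "x \<noteq> y" "q \<le> card (off {x, y})" shows "card (up {x, y}) \<le> 3 * q"
  using card_up_le_far[of "{x, y}"] assms k_ge by (simp add: q_def numeral_3_eq_3)

lemma card_up3_le: assumes "{x, y, z} \<subseteq> V" "x \<noteq> y" "x \<noteq> z" "y \<noteq> z" shows "card (up {x, y, z}) \<le> q"
  using card_up_le[of "{x, y, z}"] assms by (simp add: q_def numeral_3_eq_3)

lemma kq_pos: "3 * q \<le> k * q"
  using k_ge by simp

text \<open>Otherwise at most \<open>3 * q\<close> members contain both \<open>b\<close> and
  \<open>z\<close>. A member missing \<open>a\<close> misses \<open>b\<close>, misses
  \<open>z\<close> or contains both, so fewer than \<open>15 * q\<close> members miss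
  \<open>a\<close>, too few by \<open>off_ge\<close>.\<close>

lemma near_pair_transfer:
  assumes V: "{a, b, z} \<subseteq> V" "a \<noteq> b" "a \<noteq> z" "b \<noteq> z"
    and near: "card (off {a, b}) < 6 * q" "card (off {a, z}) < 6 * q"
  shows "card (off {b, z}) < 6 * q"
proof (rule ccontr)
  assume "\<not> ?thesis"
  then have "card (up {b, z}) \<le> 3 * q" using V by (intro card_up2_le) auto
  moreover have "off {a} \<subseteq> off {a, b} \<union> off {a, z} \<union> up {b, z}" by (auto simp: off_def up_def)
  then have "card (off {a}) \<le> card (off {a, b} \<union> off {a, z} \<union> up {b, z})" by (intro card_mono) auto
  then have "card (off {a}) \<le> card (off {a, b}) + card (off {a, z}) + card (up {b, z})"
    by (meson add_le_mono card_Un_le le_trans order_refl)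
  ultimately show False using near off_ge[of a] V kq_pos q_pos by simp
qed

text \<open>A member missing \<open>a\<close> but neither \<open>b\<close> nor \<open>c\<close> must
  meet \<open>H\<close> in a third point, which leaves at most \<open>k * q\<close> of them.
  Together with the two near pairs this is too few members missing \<open>a\<close>.\<close>

lemma near_triangle:
  assumes V: "{a, b, c} \<subseteq> V" "a \<noteq> b" "a \<noteq> c" "b \<noteq> c"
    and near: "card (off {a, b}) < 6 * q" "card (off {a, c}) < 6 * q"
    and H: "H \<in> \<G>" "b \<notin> H" "c \<notin> H"
  shows False
proof -
  have fH: "finite H" using H finite_member by blast
  have "off {a} - off {a, b} - off {a, c} \<subseteq> (\<Union>z\<in>H - {a}. up {b, c, z})"
  proof
    fix G assume G: "G \<in> off {a} - off {a, b} - off {a, c}"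
    then obtain z where "z \<in> G" "z \<in> H" using meet[of G H] H by (auto simp: off_def)
    then show "G \<in> (\<Union>z\<in>H - {a}. up {b, c, z})" using G by (auto simp: off_def up_def)
  qed
  then have "card (off {a} - off {a, b} - off {a, c}) \<le> (\<Sum>z\<in>H - {a}. card (up {b, c, z}))"
    using fH by (intro card_UN_up_le) auto
  also have "\<dots> \<le> (\<Sum>z\<in>H - {a}. q)"
    using V H uniform[OF H(1)] by (intro sum_mono card_up3_le) auto
  also have "\<dots> \<le> k * q" using uniform[OF H(1)] card_Diff1_le[of H a] by simp
  finally have "card (off {a} - off {a, b} - off {a, c}) \<le> k * q" .
  moreover have "card (off {a}) \<le> card (off {a} - off {a, b} - off {a, c}) + card (off {a, b}) + card (off {a, c})"
    using diff_card_le_card_Diff[of "off {a, b}" "off {a}"]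
      diff_card_le_card_Diff[of "off {a, c}" "off {a} - off {a, b}"] by simp
  ultimately show False using near off_ge[of a] V kq_pos q_pos by simp
qed

text \<open>If a near pair \<open>{a, b}\<close> extends to a second near pair
  \<open>{b, z}\<close>, all three pairs are near and every member contains two of the three points,
  against \<open>no_triangle\<close>. If not, branching over a member missing \<open>b\<close>
  leaves too few members missing \<open>a\<close>.\<close>

lemma off_pair_ge:
  assumes V: "a \<in> V" "b \<in> V" "a \<noteq> b"
  shows "6 * q \<le> card (off {a, b})"
proof (rule ccontr)
  assume "\<not> ?thesis"
  then have near: "card (off {a, b}) < 6 * q" by simp
  show False
  proof (cases "\<exists>z\<in>V - {a, b}. card (off {b, z}) < 6 * q")
    case True
    then obtain c where c: "c \<in> V" "c \<noteq> a" "c \<noteq> b" "card (off {b, c}) < 6 * q" by blast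
    have ac: "card (off {a, c}) < 6 * q"
      using near_pair_transfer[of b a c] V c near by (auto simp: insert_commute)
    obtain G where G: "G \<in> \<G>" "(a \<notin> G \<and> b \<notin> G) \<or> (a \<notin> G \<and> c \<notin> G) \<or> (b \<notin> G \<and> c \<notin> G)"
      using no_triangle[of a b c] V c by auto
    show False
      using G(2) near_triangle[of a b c G] near_triangle[of b a c G] near_triangle[of c a b G]
        V c ac near G(1) by (auto simp: insert_commute)
  next
    case False
    obtain G where G: "G \<in> off {b}" using off_ge[OF V(2)] q_pos off_nonempty[of "{b}"] by auto
    then have GG: "G \<in> \<G>" "b \<notin> G" by (auto simp: off_def)
    have fG: "finite G" using GG finite_member by blast
    have "off {a} - off {a, b} \<subseteq> (\<Union>z\<in>G - {a}. up {b, z})"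
    proof
      fix H assume H: "H \<in> off {a} - off {a, b}"
      then obtain z where "z \<in> G" "z \<in> H" using meet[of G H] GG by (auto simp: off_def)
      then show "H \<in> (\<Union>z\<in>G - {a}. up {b, z})" using H by (auto simp: off_def up_def)
    qed
    then have "card (off {a} - off {a, b}) \<le> (\<Sum>z\<in>G - {a}. card (up {b, z}))"
      using fG by (intro card_UN_up_le) auto
    also have "\<dots> \<le> (\<Sum>z\<in>G - {a}. 3 * q)"
    proof (intro sum_mono card_up2_le)
      fix z assume z: "z \<in> G - {a}"
      then show "z \<in> V" "b \<noteq> z" using GG uniform by auto
      moreover have "z \<in> V - {a, b}" using calculation z by blast
      ultimately have "6 * q \<le> card (off {b, z})" using False by (meson not_le)
      then show "q \<le> card (off {b, z})" by simp
    qed (rule V)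
    also have "\<dots> \<le> k * (3 * q)" using uniform[OF GG(1)] card_Diff1_le[of G a] by simp
    finally have "card (off {a} - off {a, b}) \<le> 3 * (k * q)" by simp
    moreover have "card (off {a}) \<le> card (off {a} - off {a, b}) + card (off {a, b})"
      using diff_card_le_card_Diff[of "off {a, b}" "off {a}"] by simp
    ultimately show False using near off_ge[of a] V kq_pos q_pos by simp
  qed
qed

text \<open>With two different third points, a member missing \<open>x\<close> and \<open>y\<close>
  misses one of them or contains both, which allows fewer than \<open>q + q + 3 * q\<close> members;
  this is where the threshold \<open>6 * q\<close> is used.\<close>

lemma near_triple_unique:
  assumes "{x, y, w, w'} \<subseteq> V" "x \<noteq> y"
    and "card (off {x, y, w}) < q" "card (off {x, y, w'}) < q"
  shows "w = w'"
proof (rule ccontr)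
  assume "w \<noteq> w'"
  then have "card (up {w, w'}) \<le> 3 * q"
    using assms(1) off_pair_ge[of w w'] by (intro card_up2_le) auto
  moreover have "off {x, y} \<subseteq> off {x, y, w} \<union> off {x, y, w'} \<union> up {w, w'}" by (auto simp: off_def up_def)
  then have "card (off {x, y}) \<le> card (off {x, y, w} \<union> off {x, y, w'} \<union> up {w, w'})" by (intro card_mono) auto
  then have "card (off {x, y}) \<le> card (off {x, y, w}) + card (off {x, y, w'}) + card (up {w, w'})"
    by (meson add_le_mono card_Un_le le_trans order_refl)
  ultimately show False using assms(3,4) off_pair_ge[of x y] assms(1,2) q_pos by auto
qed

text \<open>For \<open>k = 3\<close> there is no fourth point to gain from, but then a member
  containing the triple equals it and would be disjoint from a member missing it.\<close>

lemma card_up3_le_far: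
  assumes S: "{x, y, z} \<subseteq> V" "x \<noteq> y" "x \<noteq> z" "y \<noteq> z" and far: "q \<le> card (off {x, y, z})"
  shows "4 * k * card (up {x, y, z}) \<le> 3 * q"
proof (cases "k = 3")
  case True
  obtain G where G: "G \<in> off {x, y, z}" using far q_pos off_nonempty[of "{x, y, z}"] by auto
  have "up {x, y, z} = {}"
  proof (rule ccontr)
    assume "up {x, y, z} \<noteq> {}"
    then obtain H where H: "H \<in> \<G>" "{x, y, z} \<subseteq> H" by (auto simp: up_def)
    have "card {x, y, z} = card H" using uniform[OF H(1)] True S by simp
    then have "H = {x, y, z}" using card_subset_eq[OF finite_member[OF H(1)] H(2)] by simp
    then show False using G H(1) meet[of G H] by (auto simp: off_def)
  qed
  then show ?thesis by simp
next
  case False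
  then have k: "3 < k" using k_ge by simp
  have "card (up {x, y, z}) \<le> 3 * (n - Suc 3 choose (k - Suc 3))"
    using card_up_le_far[of "{x, y, z}"] S far k by (simp add: numeral_3_eq_3)
  then have "4 * k * card (up {x, y, z}) \<le> 4 * k * (3 * (n - Suc 3 choose (k - Suc 3)))" by (rule mult_le_mono2)
  also have "\<dots> \<le> 3 * q" using binomial_ratio[OF k] by (simp add: q_def)
  finally show ?thesis .
qed

text \<open>Branching over \<open>G\<close> multiplies by \<open>k\<close>, while every far triple
  gains \<open>4 * k\<close>. The factor 4 on the left avoids fractions.\<close>

lemma four_card_up2_le_far:
  assumes V: "x \<in> V" "y \<in> V" "x \<noteq> y" and G: "G \<in> off {x, y}"
    and far: "\<And>w. w \<in> G \<Longrightarrow> q \<le> card (off {x, y, w})"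
  shows "4 * card (up {x, y}) \<le> 3 * q"
proof -
  have GG: "G \<in> \<G>" "x \<notin> G" "y \<notin> G" using G by (auto simp: off_def)
  have "4 * k * card (up {x, y}) \<le> 4 * k * (\<Sum>w\<in>G. card (up (insert w {x, y})))"
    using branch[OF G] by (rule mult_le_mono2)
  also have "\<dots> = (\<Sum>w\<in>G. 4 * k * card (up {x, y, w}))"
    by (simp add: sum_distrib_left insert_commute)
  also have "\<dots> \<le> (\<Sum>w\<in>G. 3 * q)"
    using V GG uniform[OF GG(1)] far by (intro sum_mono card_up3_le_far) auto
  also have "\<dots> = k * (3 * q)" using uniform[OF GG(1)] by simp
  finally have "k * (4 * card (up {x, y})) \<le> k * (3 * q)" by (simp only: mult_ac)
  then show ?thesis using k_ge by (subst (asm) mult_le_cancel1) simp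
qed

text \<open>Only one branch can lead to a near triple; its weaker bound \<open>q\<close> accounts
  for \<open>4 * q\<close> out of \<open>7 * q\<close>.\<close>

lemma four_card_up2_le:
  assumes V: "x \<in> V" "y \<in> V" "x \<noteq> y"
  shows "4 * card (up {x, y}) \<le> 7 * q"
proof -
  obtain G where G: "G \<in> off {x, y}"
    using off_pair_ge[OF V] q_pos off_nonempty[of "{x, y}"] by auto
  have GG: "G \<in> \<G>" "x \<notin> G" "y \<notin> G" using G by (auto simp: off_def)
  show ?thesis
  proof (cases "\<exists>w\<in>G. card (off {x, y, w}) < q")
    case False
    then have "4 * card (up {x, y}) \<le> 3 * q"
      using four_card_up2_le_far[OF V G] by force
    then show ?thesis by simp
  next
    case True
    then obtain w0 where w0: "w0 \<in> G" "card (off {x, y, w0}) < q" by blast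
    have far: "q \<le> card (off {x, y, w})" if "w \<in> G - {w0}" for w
    proof (rule ccontr)
      assume "\<not> q \<le> card (off {x, y, w})"
      then show False
        using near_triple_unique[of x y w w0] that w0 V uniform[OF GG(1)] by auto
    qed
    have fG: "finite G" using GG finite_member by blast
    have "4 * k * card (up {x, y}) \<le> 4 * k * (\<Sum>w\<in>G. card (up (insert w {x, y})))"
      using branch[OF G] by (rule mult_le_mono2)
    also have "\<dots> = 4 * k * card (up {x, y, w0}) + (\<Sum>w\<in>G - {w0}. 4 * k * card (up {x, y, w}))"
      using sum.remove[OF fG w0(1), of "\<lambda>w. 4 * k * card (up {x, y, w})"]
      by (simp add: sum_distrib_left insert_commute)
    also have "\<dots> \<le> 4 * k * q + (\<Sum>w\<in>G - {w0}. 3 * q)"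
      using V GG w0 uniform[OF GG(1)] far
      by (intro add_mono mult_le_mono2 card_up3_le sum_mono card_up3_le_far) auto
    also have "\<dots> \<le> 4 * k * q + k * (3 * q)"
      using uniform[OF GG(1)] card_Diff1_le[of G w0] by simp
    finally have "k * (4 * card (up {x, y})) \<le> k * (7 * q)" by (simp add: algebra_simps)
    then show ?thesis using k_ge by (subst (asm) mult_le_cancel1) simp
  qed
qed

text \<open>The only \<open>w0\<close> giving a near triple can be avoided: some member misses
  \<open>x\<close>, \<open>y\<close> and \<open>w0\<close>, and branching over it meets far triples
  only.\<close>

lemma four_card_up2_le_uncovered:
  assumes V: "x \<in> V" "y \<in> V" "x \<noteq> y" and un: "\<And>w. w \<in> V \<Longrightarrow> off {x, y, w} \<noteq> {}"
  shows "4 * card (up {x, y}) \<le> 3 * q"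
proof (cases "\<exists>w\<in>V. card (off {x, y, w}) < q")
  case True
  then obtain w0 where w0: "w0 \<in> V" "card (off {x, y, w0}) < q" by blast
  then obtain G where G: "G \<in> off {x, y, w0}" using un by blast
  then have "G \<in> off {x, y}" "w0 \<notin> G" "G \<subseteq> V" using uniform by (auto simp: off_def)
  moreover have "q \<le> card (off {x, y, w})" if "w \<in> G" for w
  proof (rule ccontr)
    assume "\<not> q \<le> card (off {x, y, w})"
    then show False
      using near_triple_unique[of x y w w0] calculation that w0 V by auto
  qed
  ultimately show ?thesis by (intro four_card_up2_le_far[OF V, of G]) auto
next
  case False
  obtain G where G: "G \<in> off {x, y}"
    using off_pair_ge[OF V] q_pos off_nonempty[of "{x, y}"] by auto
  then have "G \<subseteq> V" using uniform by (auto simp: off_def)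
  then show ?thesis using False by (intro four_card_up2_le_far[OF V G]) force
qed

text \<open>Triples \<open>{x, y, w}\<close> meeting every member form a matching in the link of \<open>x\<close>; three
  disjoint edges would confine the members avoiding \<open>x\<close> to eight triples.\<close>
lemma card_covered_le:
  assumes x: "x \<in> V"
  shows "card {y \<in> V - {x}. \<exists>w\<in>V. off {x, y, w} = {}} \<le> 4"
proof (rule ccontr)
  let ?S = "{y \<in> V - {x}. \<exists>w\<in>V. off {x, y, w} = {}}"
  assume "\<not> ?thesis"
  then have big: "4 < card ?S" by simp
  have fS: "finite ?S" using finite_V by simp
  \<comment> \<open>After two edges of the matching at most four points are used up, so more than
    four covered points suffice for a third edge.\<close>
  have ex: "\<exists>y w. y \<in> V \<and> y \<noteq> x \<and> y \<notin> F \<and> w \<in> V \<and> off {x, y, w} = {}" if "finite F" "card F \<le> 4" for F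
  proof -
    have "\<not> ?S \<subseteq> F" using card_mono[OF that(1)] that(2) big by (meson le_trans not_le)
    then show ?thesis by blast
  qed
  \<comment> \<open>Uniqueness of the partner is what makes the three edges disjoint.\<close>
  have uniq: "w = w'" if "y \<in> V" "w \<in> V" "w' \<in> V" "y \<noteq> x" "off {x, y, w} = {}" "off {x, y, w'} = {}" for y w w'
    using near_triple_unique[of x y w w'] that x q_pos by auto
  have wx: "w \<noteq> x" "w \<noteq> y" if "y \<in> V" "y \<noteq> x" "off {x, y, w} = {}" for y w
  proof -
    have "off {x, y} \<noteq> {}" using off_pair_ge[of x y] x that q_pos by auto
    then show "w \<noteq> x" "w \<noteq> y" using that by (auto simp: insert_commute)
  qed
  obtain a b where a: "a \<in> V" "a \<noteq> x" and b: "b \<in> V" "off {x, a, b} = {}" using ex[of "{}"] by auto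
  obtain c d where c: "c \<in> V" "c \<noteq> x" "c \<noteq> a" "c \<noteq> b" and d: "d \<in> V" "off {x, c, d} = {}"
    using ex[of "{a, b}"] card_length[of "[a, b]"] by auto
  have "card {a, b, c, d} \<le> 4" using card_length[of "[a, b, c, d]"] by simp
  then obtain e f where e: "e \<in> V" "e \<noteq> x" "e \<noteq> a" "e \<noteq> b" "e \<noteq> c" "e \<noteq> d" and f: "f \<in> V" "off {x, e, f} = {}"
    using ex[of "{a, b, c, d}"] by auto
  note wb = wx[OF a b(2)] and wd = wx[OF c(1,2) d(2)] and wf = wx[OF e(1,2) f(2)]
  have sym: "off {x, b, a} = {}" "off {x, d, c} = {}" "off {x, f, e} = {}"
    using b d f by (simp_all add: insert_commute)
  have "d \<noteq> a" using uniq[OF a(1) b(1) c(1) a(2) b(2)] sym c by auto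
  moreover have "d \<noteq> b" using uniq[OF b(1) a(1) c(1) wb(1) sym(1)] sym c by auto
  moreover have "f \<noteq> a" using uniq[OF a(1) b(1) e(1) a(2) b(2)] sym e by auto
  moreover have "f \<noteq> b" using uniq[OF b(1) a(1) e(1) wb(1) sym(1)] sym e by auto
  moreover have "f \<noteq> c" using uniq[OF c(1) d(1) e(1) c(2) d(2)] sym e by auto
  moreover have "f \<noteq> d" using uniq[OF d(1) c(1) e(1) wd(1) sym(2)] sym e by auto
  ultimately have dist: "distinct [a, b, c, d, e, f]" using c e wb wd wf by auto
  let ?I = "{a, b} \<times> {c, d} \<times> {e, f}"
  have "off {x} \<subseteq> (\<Union>i\<in>?I. up {fst i, fst (snd i), snd (snd i)})"
  proof
    fix G assume G: "G \<in> off {x}"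
    have "G \<inter> {x, a, b} \<noteq> {}" "G \<inter> {x, c, d} \<noteq> {}" "G \<inter> {x, e, f} \<noteq> {}"
      using G b d f by (auto simp: off_def)
    then obtain y z w where "y \<in> {a, b}" "z \<in> {c, d}" "w \<in> {e, f}" "{y, z, w} \<subseteq> G"
      using G by (auto simp: off_def)
    then show "G \<in> (\<Union>i\<in>?I. up {fst i, fst (snd i), snd (snd i)})"
      using G by (intro UN_I[of "(y, z, w)"]) (auto simp: off_def up_def)
  qed
  then have "card (off {x}) \<le> (\<Sum>i\<in>?I. card (up {fst i, fst (snd i), snd (snd i)}))"
    by (intro card_UN_up_le) auto
  also have "\<dots> \<le> (\<Sum>i\<in>?I. q)"
    using dist a b c d e f by (intro sum_mono card_up3_le) auto
  also have "\<dots> = 8 * q" using dist by (simp add: card_cartesian_product)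
  finally show False using off_ge[OF x] kq_pos q_pos by simp
qed

text \<open>Each of the \<open>k\<close> branches costs \<open>3 * q\<close>, and the at most four
  covered points cost \<open>7 * q\<close> more each.\<close>

lemma four_card_up1_le:
  assumes x: "x \<in> V"
  shows "4 * card (up {x}) \<le> 28 * q + 3 * (k * q)"
proof -
  let ?S = "{y \<in> V - {x}. \<exists>w\<in>V. off {x, y, w} = {}}"
  obtain G where G: "G \<in> off {x}" using off_ge[OF x] q_pos off_nonempty[of "{x}"] by auto
  then have GG: "G \<in> \<G>" "x \<notin> G" "G \<subseteq> V" "card G = k" using uniform by (auto simp: off_def)
  have fG: "finite G" using GG finite_member by blast
  have "4 * card (up {x}) \<le> 4 * (\<Sum>y\<in>G. card (up (insert y {x})))"
    using branch[OF G] by (rule mult_le_mono2)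
  also have "\<dots> = (\<Sum>y\<in>G. 4 * card (up {x, y}))"
    by (simp add: sum_distrib_left insert_commute)
  also have "\<dots> \<le> (\<Sum>y\<in>G. 3 * q + (if y \<in> ?S then 7 * q else 0))"
  proof (rule sum_mono)
    fix y assume "y \<in> G"
    then have y: "y \<in> V" "x \<noteq> y" using GG by auto
    show "4 * card (up {x, y}) \<le> 3 * q + (if y \<in> ?S then 7 * q else 0)"
      using four_card_up2_le[OF x y] four_card_up2_le_uncovered[OF x y] y by auto
  qed
  also have "\<dots> = k * (3 * q) + card {y \<in> G. y \<in> ?S} * (7 * q)"
    using fG GG by (simp add: sum.distrib flip: sum.inter_filter)
  also have "card {y \<in> G. y \<in> ?S} \<le> 4"
    using card_mono[of ?S "{y \<in> G. y \<in> ?S}"] card_covered_le[OF x] finite_V by fastforce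
  then have "k * (3 * q) + card {y \<in> G. y \<in> ?S} * (7 * q) \<le> k * (3 * q) + 4 * (7 * q)"
    by (intro add_left_mono mult_le_mono1)
  finally show ?thesis by simp
qed

lemma card_family_le:
  assumes "finite S"
  shows "card \<G> \<le> card (off S) + (\<Sum>x\<in>S. card (up {x}))"
proof -
  have "\<G> - off S \<subseteq> (\<Union>x\<in>S. up {x})" by (auto simp: off_def up_def)
  then have "card (\<G> - off S) \<le> (\<Sum>x\<in>S. card (up {x}))" by (rule card_UN_up_le[OF assms])
  then show ?thesis using diff_card_le_card_Diff[of "off S" \<G>] by simp
qed

lemma off_le_family: "card (off S) \<le> card \<G>"
  using finite_family by (intro card_mono) (auto simp: off_def)

text \<open>Every member misses \<open>S\<close> or contains one of its three points; the bounds on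
  the degrees then make the whole family smaller than the part missing one point.\<close>

lemma off_triple_ge:
  assumes "S \<subseteq> V" "card S = 3"
  shows "q \<le> card (off S)"
proof (rule ccontr)
  assume near: "\<not> ?thesis"
  have fS: "finite S" using assms(2) by (metis card.infinite zero_neq_numeral)
  obtain x where x: "x \<in> S" using assms(2) by fastforce
  have "4 * (\<Sum>x\<in>S. card (up {x})) \<le> (\<Sum>x\<in>S. 28 * q + 3 * (k * q))"
    unfolding sum_distrib_left using assms(1) by (intro sum_mono four_card_up1_le) auto
  also have "\<dots> = 84 * q + 9 * (k * q)" using assms(2) by simp
  finally show False
    using card_family_le[OF fS] near off_gt[of x] off_le_family[of "{x}"] x assms(1) by auto
qed

text \<open>A smallest set of at least three points that is missed by fewer than \<open>q\<close> members
  exists, because no member is missed by any member.\<close>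
lemma contradiction: False
proof -
  define P where "P r \<longleftrightarrow> 3 \<le> r \<and> (\<exists>S\<subseteq>V. card S = r \<and> card (off S) < q)" for r
  have "V \<noteq> {}" using k_less_n by auto
  then obtain v where v: "v \<in> V" by blast
  then obtain G where G: "G \<in> \<G>" using off_ge[OF v] q_pos off_nonempty[of "{v}"] by (auto simp: off_def)
  then have "off G = {}" using meet[OF _ G] by (auto simp: off_def)
  then have Pk: "P k" unfolding P_def using G uniform k_ge q_pos by (intro conjI exI[of _ G]) auto
  define r where "r = (LEAST r. P r)"
  have Pr: "P r" unfolding r_def using Pk by (rule LeastI)
  have rk: "r \<le> k" unfolding r_def using Pk by (rule Least_le)
  obtain S where S: "S \<subseteq> V" "card S = r" "card (off S) < q" using Pr P_def by blast
  have r4: "4 \<le> r"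
  proof (rule ccontr)
    assume "\<not> 4 \<le> r"
    then have "r = 3" using Pr P_def by auto
    then show False using off_triple_ge[of S] S by auto
  qed
  \<comment> \<open>Minimality of \<open>r\<close> covers the sizes from 3 on; one or two points are
    covered by the earlier lower bounds.\<close>
  have far: "q \<le> card (off T)" if T: "T \<subseteq> V" "1 \<le> card T" "card T < r" for T
  proof -
    consider "card T = 1" | "card T = 2" | "3 \<le> card T" using T by linarith
    then show ?thesis
    proof cases
      case 1
      then obtain x where "T = {x}" using card_1_singletonE by blast
      then show ?thesis using off_ge[of x] T by simp
    next
      case 2
      then obtain x y where "T = {x, y}" "x \<noteq> y" by (meson card_2_iff)
      then show ?thesis using off_pair_ge[of x y] T by simp
    next
      case 3
      have "\<not> P (card T)" using not_less_Least[of "card T" P] T(3) r_def by simp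
      then show ?thesis using 3 T(1) unfolding P_def by (metis not_le)
    qed
  qed
  define N where "N = n - r choose (k - r)"
  \<comment> \<open>Branching \<open>i\<close> times enlarges \<open>T\<close> to
    \<open>r - 1\<close> points, all the while staying among sets missed by at least
    \<open>q\<close> members; at that size \<open>card_up_le_far\<close> gives
    \<open>3 * N\<close>.\<close>
  have deg: "card (up T) \<le> k ^ i * (3 * N)" if "T \<subseteq> V" "card T + i = r - 1" "1 \<le> card T" for T i
    using that
  proof (induction i arbitrary: T)
    case 0
    then have c: "card T < r" "Suc (card T) = r" "card T < k" using r4 rk by auto
    show ?case using card_up_le_far[OF 0(1) c(3) far[OF 0(1,3) c(1)]] c(2) by (simp add: N_def)
  next
    case (Suc i)
    then have "q \<le> card (off T)" by (intro far) auto
    then obtain G where G: "G \<in> off T" using q_pos off_nonempty[of T] by auto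
    then have GG: "G \<in> \<G>" "G \<inter> T = {}" "G \<subseteq> V" "card G = k" using uniform by (auto simp: off_def)
    have fT: "finite T" using Suc.prems finite_V finite_subset by blast
    have "card (up T) \<le> (\<Sum>y\<in>G. card (up (insert y T)))" by (rule branch[OF G])
    also have "\<dots> \<le> (\<Sum>y\<in>G. k ^ i * (3 * N))"
    proof (intro sum_mono Suc.IH)
      fix y assume y: "y \<in> G"
      then have "card (insert y T) = Suc (card T)" using GG(2) fT by (intro card_insert_disjoint) auto
      then show "insert y T \<subseteq> V" "card (insert y T) + i = r - 1" "1 \<le> card (insert y T)"
        using y GG(3) Suc.prems by auto
    qed
    also have "\<dots> = k ^ Suc i * (3 * N)" using GG by simp
    finally show ?case .
  qed
  \<comment> \<open>Gives \<open>r \<le> 4 ^ i\<close>, which absorbs the number of points of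
    \<open>S\<close>; it fails for \<open>i = 0\<close>, hence the separate treatment of
    triples.\<close>
  have pow: "3 + i < 4 ^ i + 1" if "1 \<le> i" for i :: nat
    using that by (induction i rule: dec_induct) auto
  obtain i where i: "r = 3 + i" "1 \<le> i"
  proof (rule that)
    show "r = 3 + (r - 3)" "1 \<le> r - 3" using r4 by auto
  qed
  \<comment> \<open>A single point needs \<open>i + 1\<close> further points to reach size
    \<open>r - 1 = i + 2\<close>.\<close>
  have "(\<Sum>x\<in>S. card (up {x})) \<le> (\<Sum>x\<in>S. k ^ (i + 1) * (3 * N))"
    using S(1) i by (intro sum_mono deg) auto
  also have "\<dots> = r * (k ^ (i + 1) * (3 * N))" using S(2) by simp
  also have "\<dots> \<le> 4 ^ i * (k ^ (i + 1) * (3 * N))"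
    using pow[OF i(2)] i(1) by (intro mult_le_mono1) simp
  also have "\<dots> = 3 * (k * ((4 * k) ^ i * N))" by (simp add: power_mult_distrib)
  also have "\<dots> \<le> 3 * (k * q)"
    using power_binomial_le[of i] rk i(1) by (simp add: N_def)
  finally have "(\<Sum>x\<in>S. card (up {x})) \<le> 3 * (k * q)" .
  moreover have "finite S" using S(1) finite_V finite_subset by blast
  \<comment> \<open>The family has fewer than \<open>q + 3 * (k * q)\<close> members, which is less
    than the number of those missing \<open>v\<close>.\<close>
  ultimately show False
    using card_family_le[of S] S(3) off_ge[OF v] off_le_family[of "{v}"] q_pos by linarith
qed

end

text \<open>The threshold in \<open>small\<close> is the one that averaging over the points other
  than \<open>x\<close> turns into \<open>n - 4 choose (k - 3)\<close>.\<close>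

theorem (in intersecting_family) small_diversity_or_triangle:
  obtains (small) x where "x \<in> V" "k * card (off {x}) < (n - k) * q"
  | (triangle) a b c where "{a, b, c} \<subseteq> V" "a \<noteq> b" "a \<noteq> c" "b \<noteq> c"
    "\<And>G. G \<in> \<G> \<Longrightarrow> (a \<in> G \<or> b \<in> G) \<and> (a \<in> G \<or> c \<in> G) \<and> (b \<in> G \<or> c \<in> G)"
proof (rule ccontr)
  assume "\<not> thesis"
  have "spread_family V \<G> k"
  proof (intro spread_family.intro intersecting_family_axioms spread_family_axioms.intro)
    show "(n - k) * q \<le> k * card (off {x})" if "x \<in> V" for x
      using \<open>\<not> thesis\<close> small that by (meson not_le)
    show "\<exists>G\<in>\<G>. (a \<notin> G \<and> b \<notin> G) \<or> (a \<notin> G \<and> c \<notin> G) \<or> (b \<notin> G \<and> c \<notin> G)"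
      if "{a, b, c} \<subseteq> V" "a \<noteq> b" "a \<noteq> c" "b \<noteq> c" for a b c
      using \<open>\<not> thesis\<close> triangle[OF that] by blast
  qed
  then show False by (rule spread_family.contradiction)
qed

section \<open>Consequences of the dichotomy\<close>

context intersecting_family
begin

lemma card_off_small:
  obtains x where "x \<in> V" "card (off {x}) \<le> n - 2 choose (k - 2)"
proof (cases rule: small_diversity_or_triangle)
  case (small x)
  \<comment> \<open>Absorption expresses the target by \<open>q\<close>; the bound of the case
    \<open>small\<close> is stronger than needed here.\<close>
  have "(k - 2) * (n - 2 choose (k - 2)) = (n - 2) * q"
    using Suc_times_binomial[of "k - 3" "n - 3"] k_ge k_less_n
    by (simp add: q_def numeral_2_eq_2 numeral_3_eq_3 Suc_diff_Suc)
  moreover have "(n - k) * q \<le> (n - 2) * q" using k_ge by (intro mult_le_mono1) simp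
  moreover have "(k - 2) * (n - 2 choose (k - 2)) \<le> k * (n - 2 choose (k - 2))" by (intro mult_le_mono1) simp
  ultimately have "k * card (off {x}) \<le> k * (n - 2 choose (k - 2))" using small(2) by linarith
  then have "card (off {x}) \<le> n - 2 choose (k - 2)" using k_ge by (subst (asm) mult_le_cancel1) simp
  then show ?thesis using that small(1) by blast
next
  case (triangle a b c)
  have "off {a} \<subseteq> up {b, c}" using triangle(5) by (auto simp: off_def up_def)
  then have "card (off {a}) \<le> card (up {b, c})" by (intro card_mono) auto
  also have "\<dots> \<le> n - 2 choose (k - 2)" using card_up_le[of "{b, c}"] triangle by (simp add: numeral_2_eq_2)
  finally show ?thesis using that triangle(1) by blast
qed

lemma sep_small:
  obtains i j where "i \<in> V" "j \<in> V" "i \<noteq> j" "card {G \<in> \<G>. i \<in> G \<and> j \<notin> G} \<le> n - 4 choose (k - 3)"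
proof (cases rule: small_diversity_or_triangle)
  case (small x)
  have "\<exists>i\<in>V - {x}. card {G \<in> \<G>. i \<in> G \<and> x \<notin> G} \<le> n - 4 choose (k - 3)"
  proof (rule ccontr)
    assume "\<not> ?thesis"
    then have gt: "n - 4 choose (k - 3) \<le> card {G \<in> \<G>. i \<in> G \<and> x \<notin> G}" if "i \<in> V - {x}" for i
      using that by (meson nle_le)
    \<comment> \<open>Averages over \<open>i\<close>: each member missing \<open>x\<close> is
      counted \<open>k\<close> times, and there are \<open>n - 1 \<ge> n - 3\<close> points
      \<open>i\<close>.\<close>
    have "(n - k) * q = (n - 3) * (n - 4 choose (k - 3))"
      using binomial_absorb_comp[of "n - 3" "k - 3"] k_ge by (simp add: q_def)
    also have "\<dots> \<le> (\<Sum>i\<in>V - {x}. n - 4 choose (k - 3))" using small(1) finite_V by (simp add: diff_le_mono2)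
    also have "\<dots> \<le> (\<Sum>i\<in>V - {x}. card {G \<in> \<G>. i \<in> G \<and> x \<notin> G})" by (intro sum_mono gt)
    also have "\<dots> = (\<Sum>i\<in>V - {x}. card {G \<in> off {x}. i \<in> G})"
      by (intro sum.cong arg_cong[where f = card]) (auto simp: off_def)
    also have "\<dots> = (\<Sum>G\<in>off {x}. card {i \<in> V - {x}. i \<in> G})"
      using finite_V by (intro sum_card_double_count) auto
    also have "\<dots> = (\<Sum>G\<in>off {x}. k)"
    proof (rule sum.cong[OF refl])
      fix G assume "G \<in> off {x}"
      then have "G \<subseteq> V" "card G = k" "x \<notin> G" using uniform by (auto simp: off_def)
      moreover then have "{i \<in> V - {x}. i \<in> G} = G" by blast
      ultimately show "card {i \<in> V - {x}. i \<in> G} = k" by simp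
    qed
    also have "\<dots> = k * card (off {x})" by simp
    finally show False using small(2) by simp
  qed
  then show ?thesis using that small(1) by blast
next
  case (triangle a b c)
  have "card {a, b, c} < n" using k_less_n k_ge card_length[of "[a, b, c]"] by simp
  then have "V \<noteq> {a, b, c}" by auto
  then obtain i where i: "i \<in> V" "i \<notin> {a, b, c}" using triangle(1) by blast
  \<comment> \<open>A member missing \<open>a\<close> contains \<open>b\<close> and
    \<open>c\<close>, so three of its points are prescribed within \<open>n - 1\<close>
    points.\<close>
  have "card {G \<in> \<G>. i \<in> G \<and> a \<notin> G} \<le> card {G. {i, b, c} \<subseteq> G \<and> G \<subseteq> V - {a} \<and> card G = k}"
    using triangle(5) uniform finite_V by (intro card_mono) auto
  also have "\<dots> \<le> card (V - {a}) - card {i, b, c} choose (k - card {i, b, c})"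
    using triangle i finite_V by (intro card_supersets) auto
  also have "\<dots> = n - 4 choose (k - 3)" using triangle i finite_V by (simp add: eval_nat_numeral)
  finally show ?thesis using that i triangle(1) by auto
qed

end

section \<open>Averaging the separation numbers\<close>

lemma sturdiness_le:
  assumes "i \<in> {1..n}" "j \<in> {1..n}" "i \<noteq> j"
  shows "sturdiness n \<F> \<le> sep_count \<F> i j"
  unfolding sturdiness_def
proof (rule Min_le)
  have "{sep_count \<F> i j |i j. i \<in> {1..n} \<and> j \<in> {1..n} \<and> i \<noteq> j}
      \<subseteq> (\<lambda>(i, j). sep_count \<F> i j) ` ({1..n} \<times> {1..n})" by auto
  then show "finite {sep_count \<F> i j |i j. i \<in> {1..n} \<and> j \<in> {1..n} \<and> i \<noteq> j}"
    by (rule finite_subset) simp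
qed (use assms in auto)

lemma sturdiness_le_avoiding:
  assumes F: "\<F> \<subseteq> Pow {1..n}" and x: "x \<in> {1..n}"
  shows "(n - 1) * sturdiness n \<F> \<le> (\<Sum>F\<in>avoid x \<F>. card F)"
proof -
  have fF: "finite (avoid x \<F>)" using finite_subset[OF F] by simp
  have "(n - 1) * sturdiness n \<F> = (\<Sum>i\<in>{1..n} - {x}. sturdiness n \<F>)" using x by simp
  also have "\<dots> \<le> (\<Sum>i\<in>{1..n} - {x}. sep_count \<F> i x)"
    using x by (intro sum_mono sturdiness_le) auto
  also have "\<dots> = (\<Sum>i\<in>{1..n} - {x}. card {F \<in> avoid x \<F>. i \<in> F})"
    unfolding sep_count_def by (intro sum.cong arg_cong[where f = card]) auto
  also have "\<dots> = (\<Sum>F\<in>avoid x \<F>. card {i \<in> {1..n} - {x}. i \<in> F})"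
    by (rule sum_card_double_count) (use fF in auto)
  also have "\<dots> = (\<Sum>F\<in>avoid x \<F>. card F)"
  proof (rule sum.cong[OF refl])
    fix F assume "F \<in> avoid x \<F>"
    then have "{i \<in> {1..n} - {x}. i \<in> F} = F" using F by blast
    then show "card {i \<in> {1..n} - {x}. i \<in> F} = card F" by (simp only:)
  qed
  finally show ?thesis .
qed

lemma sturdiness_le_average:
  assumes F: "\<F> \<subseteq> Pow {1..n}"
  shows "n * ((n - 1) * sturdiness n \<F>) \<le> (\<Sum>F\<in>\<F>. card F * (n - card F))"
proof -
  have fF: "finite \<F>" using finite_subset[OF F] by simp
  have "n * ((n - 1) * sturdiness n \<F>) = (\<Sum>x\<in>{1..n}. (n - 1) * sturdiness n \<F>)" by simp
  also have "\<dots> \<le> (\<Sum>x\<in>{1..n}. \<Sum>F\<in>avoid x \<F>. card F)"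
    by (intro sum_mono sturdiness_le_avoiding F)
  also have "\<dots> = (\<Sum>F\<in>\<F>. \<Sum>x\<in>{x \<in> {1..n}. x \<notin> F}. card F)"
    using fF by (intro sum.swap_restrict) auto
  also have "\<dots> = (\<Sum>F\<in>\<F>. card F * (n - card F))"
  proof (rule sum.cong[OF refl])
    fix F assume "F \<in> \<F>"
    then have "F \<subseteq> {1..n}" using F by blast
    moreover have "{x \<in> {1..n}. x \<notin> F} = {1..n} - F" by auto
    ultimately have "card {x \<in> {1..n}. x \<notin> F} = n - card F"
      by (simp add: card_Diff_subset finite_subset)
    then show "(\<Sum>x\<in>{x \<in> {1..n}. x \<notin> F}. card F) = card F * (n - card F)" by simp
  qed
  finally show ?thesis .
qed

section \<open>Pairing of levels, and part (i)\<close>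

lemma sum_by_card:
  fixes h :: "nat \<Rightarrow> nat"
  assumes "finite \<F>" "\<And>F. F \<in> \<F> \<Longrightarrow> card F \<le> m" "h 0 = 0"
  shows "(\<Sum>F\<in>\<F>. h (card F)) = (\<Sum>l\<in>{1..m}. h l * card {F \<in> \<F>. card F = l})"
proof -
  have "(\<Sum>F\<in>\<F>. h (card F)) = (\<Sum>l\<in>{..m}. \<Sum>F\<in>{F \<in> \<F>. card F = l}. h (card F))"
    using assms by (intro sum.group[symmetric]) auto
  also have "\<dots> = (\<Sum>l\<in>{..m}. h l * card {F \<in> \<F>. card F = l})"
    by (intro sum.cong) auto
  also have "\<dots> = (\<Sum>l\<in>{1..m}. h l * card {F \<in> \<F>. card F = l})"
    using assms(3) by (intro sum.mono_neutral_right) (auto simp: not_le Suc_le_eq)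
  finally show ?thesis .
qed

text \<open>The witness \<open>d\<close> counts the \<open>l\<close>-sets disjoint from some member
  of size \<open>b\<close>: as \<open>b + l = u + 1\<close>, none of them is a member, and
  \<open>disjoint_family_bound\<close> says that they are many.\<close>

lemma level_pair:
  assumes V: "finite V" "\<F> \<subseteq> Pow V"
    and un: "\<And>F F'. F \<in> \<F> \<Longrightarrow> F' \<in> \<F> \<Longrightarrow> card (F \<union> F') \<le> u"
    and u: "b \<le> u" "u < card V" "l = u + 1 - b"
  shows "\<exists>d. card {F \<in> \<F>. card F = l} + d \<le> card V choose l \<and>
    (card V - b) * card {F \<in> \<F>. card F = b} \<le> l * d"
proof (intro exI conjI)
  let ?A = "{F \<in> \<F>. card F = b}"
  let ?D = "{B. B \<subseteq> V \<and> card B = l \<and> (\<exists>A\<in>?A. A \<inter> B = {})}"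
  show "(card V - b) * card ?A \<le> l * card ?D"
    unfolding u(3) using V u un by (intro disjoint_family_bound) auto
  have "F \<notin> \<F>" if F: "F \<in> ?D" for F
  proof
    assume "F \<in> \<F>"
    obtain A where A: "A \<in> \<F>" "card A = b" "A \<inter> F = {}" using F by blast
    have "A \<subseteq> V" "F \<subseteq> V" using A(1) F V(2) by auto
    then have "finite A" "finite F" using V(1) by (auto intro: finite_subset)
    then have "card (A \<union> F) = b + l" using A F by (simp add: card_Un_disjoint)
    then show False using un[OF A(1) \<open>F \<in> \<F>\<close>] u by simp
  qed
  then have "{F \<in> \<F>. card F = l} \<inter> ?D = {}" by blast
  moreover have fin: "finite ?D" "finite {F \<in> \<F>. card F = l}"
    using V by (auto intro: finite_subset[of _ "Pow V"])
  moreover have "card ({F \<in> \<F>. card F = l} \<union> ?D) \<le> card {B. B \<subseteq> V \<and> card B = l}"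
    using V by (intro card_mono) auto
  ultimately show "card {F \<in> \<F>. card F = l} + card ?D \<le> card V choose l"
    using card_subsets[OF V(1), of l] by (simp add: card_Un_disjoint)
qed

lemma sum_pairs:
  fixes g :: "nat \<Rightarrow> nat"
  shows "(\<Sum>l\<in>{1..2 * s}. g l) = (\<Sum>l\<in>{1..s}. g l + g (2 * s + 1 - l))"
proof -
  have "{1..2 * s} = {1..s} \<union> {s + 1..2 * s}" by auto
  then have "(\<Sum>l\<in>{1..2 * s}. g l) = (\<Sum>l\<in>{1..s}. g l) + (\<Sum>l\<in>{s + 1..2 * s}. g l)"
    by (simp add: sum.union_disjoint)
  also have "(\<Sum>l\<in>{s + 1..2 * s}. g l) = (\<Sum>l\<in>{1..s}. g (2 * s + 1 - l))"
    by (rule sum.reindex_bij_witness[of _ "\<lambda>l. 2 * s + 1 - l" "\<lambda>l. 2 * s + 1 - l"]) auto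
  finally show ?thesis by (simp add: sum.distrib)
qed

lemma sturdiness_even:
  assumes F: "\<F> \<subseteq> Pow {1..n}" and un: "u_union (2 * s) \<F>" and n: "2 * s < n" "2 \<le> n"
  shows "sturdiness n \<F> \<le> (\<Sum>j<s. (n - 2) choose j)"
proof -
  define f where "f l = card {F \<in> \<F>. card F = l}" for l
  have fF: "finite \<F>" using finite_subset[OF F] by simp
  have un': "card (A \<union> B) \<le> 2 * s" if "A \<in> \<F>" "B \<in> \<F>" for A B
    using un that unfolding u_union_def by blast
  have pair: "l * (n - l) * f l + (2 * s + 1 - l) * (n - (2 * s + 1 - l)) * f (2 * s + 1 - l)
      \<le> n * ((n - 1) * (n - 2 choose (l - 1)))" if l: "l \<in> {1..s}" for l
  proof -
    define b where "b = 2 * s + 1 - l"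
    obtain d where d: "f l + d \<le> n choose l" "(n - b) * f b \<le> l * d"
    proof -
      have "b \<le> 2 * s" "2 * s < card {1..n}" "l = 2 * s + 1 - b" using l n by (auto simp: b_def)
      from level_pair[OF _ F un' this] show ?thesis using that by (auto simp: f_def)
    qed
    \<comment> \<open>This makes the missing \<open>l\<close>-sets, each of weight
      \<open>l * (n - l)\<close>, pay for the \<open>b\<close>-sets, each of weight
      \<open>b * (n - b)\<close>.\<close>
    have "b \<le> n - l" using l n by (auto simp: b_def)
    then have "b * ((n - b) * f b) \<le> (n - l) * (l * d)" using d(2) by (rule mult_le_mono)
    then have "l * (n - l) * f l + b * (n - b) * f b \<le> l * (n - l) * (f l + d)"
      by (simp add: add_mult_distrib2 mult_ac)
    also have "\<dots> \<le> l * (n - l) * (n choose l)" using d(1) by simp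
    also have "\<dots> = (n - l) * (l * (n choose l))" by simp
    also have "l * (n choose l) = n * (n - 1 choose (l - 1))"
      using l times_binomial_minus1_eq[of l n] by simp
    also have "(n - l) * (n * (n - 1 choose (l - 1))) = n * ((n - l) * (n - 1 choose (l - 1)))" by simp
    also have "(n - l) * (n - 1 choose (l - 1)) = (n - 1) * (n - 2 choose (l - 1))"
      using binomial_absorb_comp[of "n - 1" "l - 1"] l by (simp add: numeral_2_eq_2)
    finally show ?thesis unfolding b_def .
  qed
  have "n * ((n - 1) * sturdiness n \<F>) \<le> (\<Sum>F\<in>\<F>. card F * (n - card F))"
    by (rule sturdiness_le_average[OF F])
  also have "\<dots> = (\<Sum>l\<in>{1..2 * s}. l * (n - l) * f l)"
    unfolding f_def using fF un'[of F F for F] by (intro sum_by_card) auto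
  also have "\<dots> \<le> (\<Sum>l\<in>{1..s}. n * ((n - 1) * (n - 2 choose (l - 1))))"
    unfolding sum_pairs by (intro sum_mono pair)
  also have "\<dots> = n * ((n - 1) * (\<Sum>l\<in>{1..s}. n - 2 choose (l - 1)))"
    by (simp add: sum_distrib_left)
  also have "(\<Sum>l\<in>{1..s}. n - 2 choose (l - 1)) = (\<Sum>j<s. n - 2 choose j)"
    by (rule sum.reindex_bij_witness[of _ Suc "\<lambda>l. l - 1"]) auto
  finally show ?thesis using n by simp
qed

section \<open>Part (ii)\<close>

lemma binomial_add_le: "(m + j) choose Suc r \<le> (m choose Suc r) + j * (m + j - 1 choose r)"
proof (induction j)
  case (Suc j)
  have "j * (m + j - 1 choose r) \<le> j * (m + j choose r)"
    by (intro mult_le_mono2 binomial_right_mono) simp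
  then have "(m + j choose r) + (m + j choose Suc r) \<le> (m choose Suc r) + Suc j * (m + j choose r)"
    using Suc by (simp only: mult_Suc)
  then show ?case by simp
qed simp

lemma intersecting_sep_small:
  assumes uni: "\<And>G. G \<in> \<G> \<Longrightarrow> G \<subseteq> {1..n} \<and> card G = s + 1"
    and meet: "\<And>G H. G \<in> \<G> \<Longrightarrow> H \<in> \<G> \<Longrightarrow> G \<inter> H \<noteq> {}"
    and n: "4 * (s + 2)\<^sup>2 \<le> n" "36 * (s + 7) \<le> n"
  obtains i j where "i \<in> {1..n}" "j \<in> {1..n}" "i \<noteq> j"
    "card {G \<in> \<G>. i \<in> G \<and> j \<notin> G} \<le> binom (n - 4) (int s - 2)"
proof (cases "2 \<le> s")
  case True
  interpret intersecting_family "{1..n}" \<G> "s + 1"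
    using assms True by unfold_locales (auto simp: power2_eq_square algebra_simps)
  have "binom (n - 4) (int s - 2) = n - 4 choose (s + 1 - 3)"
    using True by (simp add: binom_def nat_diff_distrib)
  then show ?thesis using sep_small that by (auto simp del: One_nat_def)
next
  case False
  \<comment> \<open>For \<open>s < 2\<close> the binomial coefficient is 0, so some ordered pair
    must not be separated at all. Otherwise two members \<open>{c, b}\<close> and
    \<open>{d, 1}\<close> would be disjoint.\<close>
  have "\<exists>i j. i \<in> {1..n} \<and> j \<in> {1..n} \<and> i \<noteq> j \<and> {G \<in> \<G>. i \<in> G \<and> j \<notin> G} = {}"
  proof (rule ccontr)
    assume "\<not> ?thesis"
    then have ex: "\<exists>G\<in>\<G>. i \<in> G \<and> j \<notin> G" if "i \<in> {1..n}" "j \<in> {1..n}" "i \<noteq> j" for i j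
      using that by blast
    obtain A where A: "A \<in> \<G>" "1 \<in> A" "2 \<notin> A" using ex[of 1 2] n by auto
    have cA: "card A \<le> 2" using uni[OF A(1)] False by simp
    have fin: "finite G" if "G \<in> \<G>" for G using uni[OF that] finite_subset by blast
    \<comment> \<open>If \<open>A\<close> is the singleton of 1, any second point serves as
      \<open>b\<close>.\<close>
    obtain b where b: "A \<subseteq> {1, b}" "b \<in> {1..n}" "b \<noteq> 1"
    proof (cases "A = {1}")
      case True then show ?thesis using that[of 2] n by auto
    next
      case F: False
      then obtain b where "b \<in> A" "b \<noteq> 1" using A by blast
      then have "{1, b} = A" using A fin[OF A(1)] cA by (intro card_seteq) auto
      then show ?thesis using that \<open>b \<in> A\<close> \<open>b \<noteq> 1\<close> uni[OF A(1)] by blast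
    qed
    have out: "\<exists>c. c \<in> {1..n} \<and> c \<notin> S" if "finite S" "card S \<le> 3" for S
    proof -
      have "card S < card {1..n}" using that(2) n(2) by simp
      then have "\<not> {1..n} \<subseteq> S" using card_mono[OF that(1)] by (meson not_le)
      then show ?thesis by blast
    qed
    obtain c where c: "c \<in> {1..n}" "c \<notin> {1, b}"
      using out[of "{1, b}"] card_length[of "[1, b]"] by auto
    obtain d where d: "d \<in> {1..n}" "d \<notin> {1, b, c}"
      using out[of "{1, b, c}"] card_length[of "[1, b, c]"] by auto
    obtain C where C: "C \<in> \<G>" "c \<in> C" "1 \<notin> C" using ex[of c 1] c n by auto
    obtain D where D: "D \<in> \<G>" "d \<in> D" "b \<notin> D" using ex[of d b] d b by auto
    have "b \<in> C" using meet[OF A(1) C(1)] b C by auto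
    then have "{c, b} = C" using C c fin[OF C(1)] uni[OF C(1)] False by (intro card_seteq) auto
    moreover have "1 \<in> D" using meet[OF A(1) D(1)] b D by auto
    then have "{d, 1} = D" using D d fin[OF D(1)] uni[OF D(1)] False by (intro card_seteq) auto
    ultimately show False using meet[OF C(1) D(1)] b c d by auto
  qed
  then obtain i j where ij: "i \<in> {1..n}" "j \<in> {1..n}" "i \<noteq> j"
    and empty: "{G \<in> \<G>. i \<in> G \<and> j \<notin> G} = {}"
    by blast
  show ?thesis by (rule that[OF ij], unfold empty) simp
qed

text \<open>Sizes up to \<open>s\<close> contribute at most all sets containing \<open>i\<close> but
  not \<open>j\<close>; size \<open>s + 1\<close> is an intersecting family, and the pair is chosen
  for it.\<close>

lemma sturdiness_odd_small_sets:
  assumes F: "\<F> \<subseteq> Pow {1..n}" and un: "u_union (2 * s + 1) \<F>"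
    and n: "4 * (s + 2)\<^sup>2 \<le> n" "36 * (s + 7) \<le> n"
    and small: "\<And>F. F \<in> \<F> \<Longrightarrow> card F \<le> s + 1"
  shows "sturdiness n \<F> \<le> (\<Sum>j<s. (n - 2) choose j) + binom (n - 4) (int s - 2)"
proof -
  let ?G = "{F \<in> \<F>. card F = s + 1}"
  have fF: "finite \<F>" "\<And>F. F \<in> \<F> \<Longrightarrow> finite F"
    using finite_subset[OF F] F finite_subset[of _ "{1..n}"] by auto
  have meet: "G \<inter> H \<noteq> {}" if "G \<in> ?G" "H \<in> ?G" for G H
  proof
    assume "G \<inter> H = {}"
    then have "card (G \<union> H) = 2 * s + 2" using that fF by (simp add: card_Un_disjoint)
    then show False using un that unfolding u_union_def by fastforce
  qed
  obtain i j where ij: "i \<in> {1..n}" "j \<in> {1..n}" "i \<noteq> j"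
    "card {G \<in> ?G. i \<in> G \<and> j \<notin> G} \<le> binom (n - 4) (int s - 2)"
    using intersecting_sep_small[of ?G n s] F meet n by blast
  let ?L = "\<lambda>l. {G. {i} \<subseteq> G \<and> G \<subseteq> {1..n} - {j} \<and> card G = l + 1}"
  have L: "card (?L l) \<le> n - 2 choose l" for l
    using card_supersets[of "{1..n} - {j}" "{i}" "l + 1"] ij by (simp add: numeral_2_eq_2)
  have "{F \<in> \<F>. i \<in> F \<and> j \<notin> F} \<subseteq> (\<Union>l<s. ?L l) \<union> {G \<in> ?G. i \<in> G \<and> j \<notin> G}"
  proof
    fix H assume H: "H \<in> {F \<in> \<F>. i \<in> F \<and> j \<notin> F}"
    then have "0 < card H" using fF by (auto simp: card_gt_0_iff)
    then obtain l where "card H = l + 1" by (metis Suc_eq_plus1 gr0_conv_Suc)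
    then show "H \<in> (\<Union>l<s. ?L l) \<union> {G \<in> ?G. i \<in> G \<and> j \<notin> G}"
      using H F small[of H] by (cases "l = s") auto
  qed
  then have "sep_count \<F> i j \<le> card ((\<Union>l<s. ?L l) \<union> {G \<in> ?G. i \<in> G \<and> j \<notin> G})"
    unfolding sep_count_def using fF(1) by (intro card_mono) auto
  also have "\<dots> \<le> card (\<Union>l<s. ?L l) + card {G \<in> ?G. i \<in> G \<and> j \<notin> G}" by (rule card_Un_le)
  also have "card (\<Union>l<s. ?L l) \<le> (\<Sum>l<s. card (?L l))" by (rule card_UN_le) simp
  also have "\<dots> \<le> (\<Sum>l<s. n - 2 choose l)" by (intro sum_mono L)
  finally show ?thesis using ij sturdiness_le[OF ij(1-3), of \<F>] by linarith
qed

text \<open>A member \<open>A\<close> with at least \<open>s + 2\<close> points excludes all \<open>s\<close>-sets disjoint from it, which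
  outweighs everything gained above level \<open>s\<close>.\<close>
lemma sturdiness_odd_large_set:
  assumes F: "\<F> \<subseteq> Pow {1..n}" and un: "u_union (2 * s + 1) \<F>"
    and n: "4 * (s + 2)\<^sup>2 \<le> n" "36 * (s + 7) \<le> n"
    and large: "A \<in> \<F>" "s + 2 \<le> card A"
  shows "sturdiness n \<F> \<le> (\<Sum>j<s. (n - 2) choose j)"
proof -
  have fF: "finite \<F>" "\<And>F. F \<in> \<F> \<Longrightarrow> finite F"
    using finite_subset[OF F] F finite_subset[of _ "{1..n}"] by auto
  have un': "card (F \<union> F') \<le> 2 * s + 1" if "F \<in> \<F>" "F' \<in> \<F>" for F F'
    using un that unfolding u_union_def by blast
  have A: "card A \<le> 2 * s + 1" using un'[OF large(1,1)] by simp
  show ?thesis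
  proof (cases "2 \<le> s")
    case False
    \<comment> \<open>The size of \<open>A\<close> excludes \<open>s = 0\<close>. For
      \<open>s = 1\<close>, \<open>A\<close> already has the maximal size of a union, so no member
      has a point outside \<open>A\<close>.\<close>
    then have s: "s = 1" "card A = 3" using A large(2) by auto
    have AV: "A \<subseteq> {1..n}" using F large(1) by blast
    have "A \<noteq> {1..n}" using s n by auto
    then obtain i where i: "i \<in> {1..n}" "i \<notin> A" using AV by blast
    obtain j where j: "j \<in> A" using s by fastforce
    have "{G \<in> \<F>. i \<in> G \<and> j \<notin> G} = {}"
    proof (rule ccontr)
      assume "{G \<in> \<F>. i \<in> G \<and> j \<notin> G} \<noteq> {}"
      then obtain G where G: "G \<in> \<F>" "i \<in> G" by blast
      have "card (insert i A) \<le> card (A \<union> G)" using G fF large(1) by (intro card_mono) auto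
      then show False using un'[OF large(1) G(1)] i s fF(2)[OF large(1)] by simp
    qed
    then have "sep_count \<F> i j = 0" unfolding sep_count_def by (metis card.empty)
    then show ?thesis using sturdiness_le[of i n j \<F>] i j AV by fastforce
  next
    case s: True
    let ?G = "{F \<in> \<F>. card F = s + 1}"
    have meet: "G \<inter> H \<noteq> {}" if "G \<in> ?G" "H \<in> ?G" for G H
    proof
      assume "G \<inter> H = {}"
      then have "card (G \<union> H) = 2 * s + 2" using that fF by (simp add: card_Un_disjoint)
      then show False using un'[of G H] that by simp
    qed
    interpret intersecting_family "{1..n}" ?G "s + 1"
      using n s F meet by unfold_locales (auto simp: power2_eq_square algebra_simps)
    \<comment> \<open>Averaging is over the pairs \<open>(i, x)\<close> only, so members weigh
      \<open>card F\<close> and live on the \<open>n - 1\<close> points of \<open>V\<close>.\<close>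
    obtain x where x: "x \<in> {1..n}" "card (off {x}) \<le> n - 2 choose (s - 1)"
      using card_off_small by auto
    define \<H> where "\<H> = avoid x \<F>"
    define g where "g l = card {F \<in> \<H>. card F = l}" for l
    define V where "V = {1..n} - {x}"
    have V: "finite V" "card V = n - 1" "\<H> \<subseteq> Pow V" using F x by (auto simp: V_def \<H>_def)
    have Hun: "card (F \<union> F') \<le> 2 * s + 1" if "F \<in> \<H>" "F' \<in> \<H>" for F F'
      using un' that by (simp add: \<H>_def)
    have nn: "(s + 2) * (s + 2) * 4 \<le> n" using n(1) by (simp add: power2_eq_square algebra_simps)
    have n4: "8 * (s + 2) \<le> n"
      using nn mult_le_mono1[of 2 "s + 2" "(s + 2) * 4"] by (simp add: mult_ac)
    have lb: "\<exists>d. g l + d \<le> n - 1 choose l \<and> (n - 1 - (2 * s + 2 - l)) * g (2 * s + 2 - l) \<le> l * d"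
      if "1 \<le> l" "l \<le> s" for l
    proof -
      have "2 * s + 2 - l \<le> 2 * s + 1" "2 * s + 1 < card V" "l = 2 * s + 1 + 1 - (2 * s + 2 - l)"
        using that n4 V(2) by auto
      from level_pair[OF V(1,3) Hun this] show ?thesis by (simp only: g_def V(2))
    qed
    have pair: "l * g l + (2 * s + 2 - l) * g (2 * s + 2 - l) \<le> l * (n - 1 choose l)" if l: "l \<in> {1..<s}" for l
    proof -
      obtain d where d: "g l + d \<le> n - 1 choose l" "(n - 1 - (2 * s + 2 - l)) * g (2 * s + 2 - l) \<le> l * d"
        using lb[of l] l by auto
      have "(2 * s + 2 - l) * g (2 * s + 2 - l) \<le> (n - 1 - (2 * s + 2 - l)) * g (2 * s + 2 - l)"
        using n4 by (intro mult_le_mono1) simp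
      also note d(2)
      finally have "l * g l + (2 * s + 2 - l) * g (2 * s + 2 - l) \<le> l * (g l + d)"
        by (simp only: add_mult_distrib2 add_le_mono order_refl)
      also have "\<dots> \<le> l * (n - 1 choose l)" using d(1) by simp
      finally show ?thesis .
    qed
    \<comment> \<open>Level \<open>s + 1\<close> is its own partner, so level \<open>s\<close> has
      to pay for levels \<open>s + 1\<close> and \<open>s + 2\<close>. Each of the two lower bounds
      \<open>d1\<close> and \<open>d2\<close> on the number of its missing sets covers one of these
      debts twice; their average covers both.\<close>
    have mid: "s * g s + (s + 1) * g (s + 1) + (s + 2) * g (s + 2) \<le> s * (n - 1 choose s)"
    proof -
      define E where "E = n - 2 choose (s - 1)"
      obtain d1 where d1: "g s + d1 \<le> n - 1 choose s" "(n - 1 - (s + 2)) * g (s + 2) \<le> s * d1"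
        using lb[of s] s by auto
      have "2 * (s + 2) * g (s + 2) \<le> (n - 1 - (s + 2)) * g (s + 2)"
        using n4 by (intro mult_le_mono1) simp
      then have e1: "2 * ((s + 2) * g (s + 2)) \<le> s * d1" using d1(2) by simp
      have "{F \<in> \<H>. card F = s + 1} = off {x}" unfolding \<H>_def off_def by auto
      then have gE: "g (s + 1) \<le> E" using x(2) by (simp add: g_def E_def)
      \<comment> \<open>With exactly \<open>s + 2\<close> points, \<open>B\<close> and a disjoint
        \<open>s\<close>-set have a union of size \<open>2 * s + 2\<close>, one too many.\<close>
      obtain B where B: "B \<subseteq> A" "card B = s + 2" "finite B"
        using obtain_subset_with_card_n[OF large(2)] fF(2)[OF large(1)] finite_subset by metis
      define d2 where "d2 = n - 1 - (s + 2) choose s"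
      have d2: "g s + d2 \<le> n - 1 choose s"
      proof -
        let ?D = "{X. X \<subseteq> V - B \<and> card X = s}"
        \<comment> \<open>Only an inequality, since \<open>B\<close> may contain
          \<open>x\<close>.\<close>
        have "n - 1 - (s + 2) \<le> card (V - B)" using diff_card_le_card_Diff[OF B(3), of V] B(2) V(2) by simp
        then have "d2 \<le> card (V - B) choose s" unfolding d2_def by (rule binomial_right_mono)
        also have "\<dots> = card ?D" using V(1) by (simp add: card_subsets)
        finally have "d2 \<le> card ?D" .
        moreover have "X \<notin> \<F>" if X: "X \<in> ?D" for X
        proof
          assume "X \<in> \<F>"
          have "finite X" using X V(1) finite_subset by blast
          then have "card (B \<union> X) = 2 * s + 2" using X B by (subst card_Un_disjoint) auto
          moreover have "card (B \<union> X) \<le> card (A \<union> X)"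
            using B fF \<open>X \<in> \<F>\<close> large(1) by (intro card_mono) auto
          ultimately show False using un'[OF large(1) \<open>X \<in> \<F>\<close>] by simp
        qed
        then have "{F \<in> \<H>. card F = s} \<inter> ?D = {}" by (auto simp: \<H>_def)
        moreover have "finite ?D" "finite {F \<in> \<H>. card F = s}"
          using V by (auto intro: finite_subset[of _ "Pow V"])
        moreover have "card ({F \<in> \<H>. card F = s} \<union> ?D) \<le> card {X. X \<subseteq> V \<and> card X = s}"
          using V by (intro card_mono) auto
        ultimately show ?thesis
          using card_subsets[OF V(1), of s] V(2) by (simp add: card_Un_disjoint g_def)
      qed
      \<comment> \<open>Each point of \<open>B\<close> destroys at most \<open>E\<close> sets. With
        \<open>s * (n - 1 choose s) = (n - 1) * E\<close> this leaves at least
        \<open>(n - 1 - s * (s + 2)) * E\<close> for \<open>s * d2\<close>, and the quadratic bound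
        on \<open>n\<close> makes that at least \<open>2 * (s + 1) * E\<close>.\<close>
      have "n - 1 choose s \<le> d2 + (s + 2) * E"
      proof -
        have "n - 1 - (s + 2) + (s + 2) = n - 1" "Suc (s - 1) = s" "n - 1 - 1 = n - 2"
          using s n4 by auto
        then show ?thesis
          using binomial_add_le[of "n - 1 - (s + 2)" "s + 2" "s - 1"] by (simp only: d2_def E_def)
      qed
      then have "s * (n - 1 choose s) \<le> s * (d2 + (s + 2) * E)" by (rule mult_le_mono2)
      moreover have "s * (n - 1 choose s) = (n - 1) * E"
        using times_binomial_minus1_eq[of s "n - 1"] s by (simp add: E_def numeral_2_eq_2)
      moreover have "(s * (s + 2) + 2 * (s + 1)) * E \<le> (n - 1) * E"
        using nn by (intro mult_le_mono1) (simp add: algebra_simps)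
      ultimately have "2 * ((s + 1) * E) \<le> s * d2" by (simp add: algebra_simps)
      moreover have "(s + 1) * g (s + 1) \<le> (s + 1) * E" using gE by (rule mult_le_mono2)
      ultimately have e2: "2 * ((s + 1) * g (s + 1)) \<le> s * d2" by linarith
      have "s * g s + s * d1 \<le> s * (n - 1 choose s)" "s * g s + s * d2 \<le> s * (n - 1 choose s)"
        using mult_le_mono2[OF d1(1), of s] mult_le_mono2[OF d2, of s] by (simp_all only: add_mult_distrib2)
      then show ?thesis using e1 e2 by linarith
    qed
    have "(n - 1) * sturdiness n \<F> \<le> (\<Sum>F\<in>\<H>. card F)"
      unfolding \<H>_def by (rule sturdiness_le_avoiding[OF F x(1)])
    also have "\<dots> = (\<Sum>l\<in>{1..2 * s + 1}. l * g l)"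
      unfolding g_def using fF(1) Hun[of F F for F] by (intro sum_by_card) (auto simp: \<H>_def)
    also have "\<dots> = (\<Sum>l\<in>{1..<s}. l * g l + (2 * s + 2 - l) * g (2 * s + 2 - l))
        + (s * g s + (s + 1) * g (s + 1) + (s + 2) * g (s + 2))"
    proof -
      have "{1..2 * s + 1} = {1..<s} \<union> {s, s + 1, s + 2} \<union> {s + 3..2 * s + 1}" using s by auto
      then have "(\<Sum>l\<in>{1..2 * s + 1}. l * g l)
          = (\<Sum>l\<in>{1..<s}. l * g l) + (\<Sum>l\<in>{s, s + 1, s + 2}. l * g l) + (\<Sum>l\<in>{s + 3..2 * s + 1}. l * g l)"
        by (simp only:) (subst sum.union_disjoint; auto simp: sum.union_disjoint)
      also have "(\<Sum>l\<in>{s + 3..2 * s + 1}. l * g l) = (\<Sum>l\<in>{1..<s}. (2 * s + 2 - l) * g (2 * s + 2 - l))"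
        by (rule sum.reindex_bij_witness[of _ "\<lambda>l. 2 * s + 2 - l" "\<lambda>l. 2 * s + 2 - l"]) auto
      finally show ?thesis by (simp add: sum.distrib)
    qed
    also have "\<dots> \<le> (\<Sum>l\<in>{1..<s}. l * (n - 1 choose l)) + s * (n - 1 choose s)"
      by (intro add_mono sum_mono pair mid)
    also have "\<dots> = (\<Sum>l\<in>{1..s}. l * (n - 1 choose l))"
      using s by (simp add: atLeastLessThanSuc_atLeastAtMost[symmetric] del: atLeastLessThanSuc_atLeastAtMost)
    also have "\<dots> = (\<Sum>l\<in>{1..s}. (n - 1) * (n - 2 choose (l - 1)))"
      using times_binomial_minus1_eq[of _ "n - 1"] by (intro sum.cong) (auto simp: numeral_2_eq_2)
    also have "\<dots> = (n - 1) * (\<Sum>l\<in>{1..s}. n - 2 choose (l - 1))" by (simp add: sum_distrib_left)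
    also have "(\<Sum>l\<in>{1..s}. n - 2 choose (l - 1)) = (\<Sum>j<s. n - 2 choose j)"
      by (rule sum.reindex_bij_witness[of _ Suc "\<lambda>l. l - 1"]) auto
    finally show ?thesis using n4 by simp
  qed
qed

theorem theorem5p10:
  fixes n u s :: nat and \<F> :: "nat set set"
  assumes "n \<ge> 2"
    and "\<F> \<subseteq> Pow {1..n}"
    and "u_union u \<F>"
  shows "(u = 2 * s \<and> n > u \<longrightarrow>
            sturdiness n \<F> \<le> (\<Sum>j<s. (n - 2) choose j)) \<and>
         (u = 2 * s + 1 \<and> n \<ge> max (4 * (s + 2)\<^sup>2) (36 * (s + 7)) \<longrightarrow>
            sturdiness n \<F> \<le> (\<Sum>j<s. (n - 2) choose j) + binom (n - 4) (int s - 2))"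
proof (intro conjI impI; elim conjE)
  assume "u = 2 * s" "u < n"
  then show "sturdiness n \<F> \<le> (\<Sum>j<s. (n - 2) choose j)"
    using sturdiness_even assms by blast
next
  assume u: "u = 2 * s + 1" and n: "max (4 * (s + 2)\<^sup>2) (36 * (s + 7)) \<le> n"
  show "sturdiness n \<F> \<le> (\<Sum>j<s. (n - 2) choose j) + binom (n - 4) (int s - 2)"
  proof (cases "\<exists>A\<in>\<F>. s + 2 \<le> card A")
    case True
    then show ?thesis using sturdiness_odd_large_set[OF assms(2)] assms(3) u n by (force intro: trans_le_add1)
  next
    case False
    then show ?thesis
      using sturdiness_odd_small_sets[OF assms(2)] assms(3) u n by force
  qed
qed

end
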